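(* Let $\Lambda$ be a nonempty finite set, $T\in\mathbb{R}^{\Lambda\times\Lambda}$ a fixed symmetric matrix, and $V=\mathrm{diag}((v_x)_{x\in\Lambda})$ a diagonal matrix with independent random real entries, $v_x$ having law $\rho_x$. Put $H=T+V$ and assume that (1) each $\rho_x$ is absolutely continuous with respect to Lebesgue measure, with density $\frac{d\rho_x}{dv_x}$; (2) $\mathrm{Spec}(H)\subset[0,1]$ almost surely; (3) the eigenvalues of $H$ are almost surely non-degenerate (simple). Let $\mu_1$ and $\mu_2$ be the two probability laws on $\Omega=\mathbb{R}^{\Lambda}\times[0,1]\times\mathbb{S}^{\Lambda-1}\times\Lambda$ of a random quadruple $(V,\lambda,\phi_\lambda,x^* )$ constructed in the context. Then $\mu_1$ is absolutely continuous with respect to $\mu_2$, with Radon–Nikodym derivative $$\frac{d\mu_1}{d\mu_2}(V,\lambda,\phi_\lambda,x^* )=\frac{d\rho_{x^*}}{dv_{x^*}}(v_{x^*}).$$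
   Context: Notation: $\mathbb{S}^{\Lambda-1}=\{u\in\mathbb{R}^\Lambda:\|u\|_{2}=1\}$. Eigenvectors are normalized and only defined up to sign, so points $\phi$ and $-\phi$ of $\mathbb{S}^{\Lambda-1}$ are identified (equivalently, only test functions on $\Omega$ invariant under $\phi\mapsto-\phi$ are considered). The matrix $V$ is identified with $(v_x)_{x\in\Lambda}\in\mathbb{R}^\Lambda$. For $x\in\Lambda$, $1_x$ is the corresponding standard basis vector and $H_{v_x=0}$ is the matrix $H$ with $v_x$ replaced by $0$, so $H=H_{v_x=0}+v_x1_x1_x^*$. Construction of $\mu_1$: (i) draw $V$ with law $\otimes_{x\in\Lambda}\rho_x$; (ii) choose an eigenvalue $\lambda$ of $H=T+V$ uniformly among its $|\Lambda|$ eigenvalues and let $\phi_\lambda$ be the corresponding unit eigenvector; (iii) choose $x^*\in\Lambda$ with conditional law $\mathbb{P}(x^*=x\mid V,\lambda,\phi_\lambda)=|\phi_\lambda(x)|^2$. Then $\mu_1$ is the law of $(V,\lambda,\phi_\lambda,x^* )$. Construction of $\mu_2$: (i) draw $\lambda$ uniformly in $[0,1]$; (ii) independently choose $x^*\in\Lambda$ uniformly; (iii) draw $(v_y)_{y\in\Lambda\setminus\{x^*\}}$ with law $\otimes_{y\in\Lambda\setminus\{x^*\}}\rho_y$, independently of $\lambda$; (iv) set $$v_{x^*}=-\frac{1}{\big((H_{v_{x^*}=0}-\lambda)^{-1}\big)_{x^*x^*}},\qquad \phi_\lambda=\frac{(H_{v_{x^*}=0}-\lambda)^{-1}1_{x^*}}{\|(H_{v_{x^*}=0}-\lambda)^{-1}1_{x^*}\|}$$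 (these expressions are defined almost surely), so that $\lambda$ is an eigenvalue of $H=T+V$ with eigenvector $\phi_\lambda$. Then $\mu_2$ is the law of $(V,\lambda,\phi_\lambda,x^* )$. *)

theory Defs
  imports "HOL-Probability.Probability"
begin

definition diag_mat :: "real^'n \<Rightarrow> real^'n^'n" where
  "diag_mat v = (\<chi> i j. if i = j then v $ i else 0)"

definition ham :: "real^'n^'n \<Rightarrow> real^'n \<Rightarrow> real^'n^'n" where
  "ham T v = T + diag_mat v"

text \<open>Only real eigenvalues are collected; for the symmetric matrices used here these are all
  the eigenvalues.\<close>

definition spec :: "real^'n^'n \<Rightarrow> real set" where
  "spec A = {l. \<exists>u. u \<noteq> 0 \<and> A *v u = l *\<^sub>R u}"

definition nondegenerate :: "real^'n^'n \<Rightarrow> bool" where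
  "nondegenerate A \<longleftrightarrow> (\<forall>l\<in>spec A. dim {u. A *v u = l *\<^sub>R u} = 1)"

text \<open>For a nondegenerate eigenvalue the choice is unique up to sign.\<close>

definition unit_eigvec :: "real^'n^'n \<Rightarrow> real \<Rightarrow> real^'n" where
  "unit_eigvec A l = (SOME u. norm u = 1 \<and> A *v u = l *\<^sub>R u)"

definition potential_law :: "('n::finite \<Rightarrow> real measure) \<Rightarrow> (real^'n) measure" where
  "potential_law \<rho> = distr (Pi\<^sub>M UNIV \<rho>) borel (\<lambda>w. \<chi> x. w x)"

type_synonym 'n quad = "(real^'n) \<times> real \<times> (real^'n) \<times> 'n"

definition Omega_set :: "'n::finite quad set" where
  "Omega_set = UNIV \<times> {0..1} \<times> sphere 0 1 \<times> UNIV"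

definition flip :: "'n::finite quad \<Rightarrow> 'n quad" where
  "flip = (\<lambda>(v, l, \<phi>, x). (v, l, - \<phi>, x))"

text \<open>Eigenvectors are defined up to sign, so \<open>Omega\<close> carries the \<open>\<sigma>\<close>-algebra of those Borel
  sets that are invariant under \<open>flip\<close>; its real measurable functions are the Borel functions
  invariant under \<open>flip\<close>.\<close>

definition Omega_sets :: "'n::finite quad set set" where
  "Omega_sets = {A. A \<in> sets (borel \<Otimes>\<^sub>M borel \<Otimes>\<^sub>M borel \<Otimes>\<^sub>M count_space UNIV)
      \<and> A \<subseteq> Omega_set \<and> flip ` A = A}"

definition Omega :: "'n::finite quad measure" where
  "Omega = sigma Omega_set Omega_sets"

lemma flip_flip [simp]: "flip (flip q) = q"
  by (cases q) (simp add: flip_def)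

lemma flip_in_Omega_set: "flip q \<in> Omega_set \<longleftrightarrow> q \<in> Omega_set"
  by (cases q) (auto simp: flip_def Omega_set_def)

lemma sigma_algebra_Omega_sets: "sigma_algebra Omega_set (Omega_sets :: 'n::finite quad set set)"
proof -
  let ?B = "borel \<Otimes>\<^sub>M borel \<Otimes>\<^sub>M borel \<Otimes>\<^sub>M count_space UNIV :: 'n quad measure"
  have S: "(Omega_set :: 'n quad set) \<in> sets ?B"
    unfolding Omega_set_def by (intro pair_measureI) auto
  have inj: "inj (flip :: 'n quad \<Rightarrow> 'n quad)"
    by (metis flip_flip injI)
  have flipS: "flip ` Omega_set = (Omega_set :: 'n quad set)"
  proof (intro equalityI subsetI)
    fix q :: "'n quad" assume "q \<in> flip ` Omega_set"
    then show "q \<in> Omega_set" by (metis flip_in_Omega_set imageE)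
  next
    fix q :: "'n quad" assume "q \<in> Omega_set"
    then show "q \<in> flip ` Omega_set" by (metis flip_flip flip_in_Omega_set imageI)
  qed
  show ?thesis
    unfolding sigma_algebra_iff2
  proof (intro conjI ballI allI impI)
    show "Omega_sets \<subseteq> Pow (Omega_set :: 'n quad set)" "{} \<in> (Omega_sets :: 'n quad set set)"
      by (auto simp: Omega_sets_def)
  next
    fix A :: "'n quad set" assume "A \<in> Omega_sets"
    then show "Omega_set - A \<in> Omega_sets"
      using S by (auto simp: Omega_sets_def image_set_diff[OF inj] flipS)
  next
    fix A :: "nat \<Rightarrow> 'n quad set" assume "range A \<subseteq> Omega_sets"
    then have *: "A i \<in> sets ?B" "A i \<subseteq> Omega_set" "flip ` A i = A i" for i
      by (auto simp: Omega_sets_def)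
    show "\<Union> (range A) \<in> Omega_sets"
      unfolding Omega_sets_def mem_Collect_eq
    proof (intro conjI)
      show "\<Union> (range A) \<in> sets ?B" using *(1) by (intro sets.countable_UN) blast
      show "\<Union> (range A) \<subseteq> Omega_set" using *(2) by blast
      show "flip ` \<Union> (range A) = \<Union> (range A)" by (simp only: image_UN *(3))
    qed
  qed
qed

lemma space_Omega: "space Omega = Omega_set"
  and sets_Omega: "sets Omega = Omega_sets"
  unfolding Omega_def
  by (simp_all only: sigma_algebra.sets_measure_of_eq sigma_algebra.space_measure_of_eq
        sigma_algebra_Omega_sets)

text \<open>The potential is restricted to an event that has full probability whenever the
  spectrum of \<open>ham T v\<close> is almost surely simple and contained in \<open>[0,1]\<close>.\<close>

definition good_potentials :: "real^'n^'n \<Rightarrow> (real^'n) set" where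
  "good_potentials T = {v. nondegenerate (ham T v) \<and> spec (ham T v) \<subseteq> {0..1}}"

definition mu1 :: "real^'n^'n \<Rightarrow> ('n::finite \<Rightarrow> real measure) \<Rightarrow> 'n quad measure" where
  "mu1 T \<rho> =
     restrict_space (potential_law \<rho>) (good_potentials T) \<bind> (\<lambda>v.
     uniform_count_measure (spec (ham T v)) \<bind> (\<lambda>l.
     let \<phi> = unit_eigvec (ham T v) l in
     distr (point_measure UNIV (\<lambda>x. ennreal ((\<phi> $ x)\<^sup>2))) Omega (\<lambda>x. (v, l, \<phi>, x))))"

text \<open>Here \<open>w\<close> is the family of the potential values off \<open>x\<close>, and \<open>resolvent T l x w\<close>
  is the inverse of \<open>H - l\<close>, where \<open>H\<close> has potential \<open>w\<close> off \<open>x\<close> and potential \<open>0\<close> at \<open>x\<close>.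
  It is meaningful only where \<open>H - l\<close> is invertible, hence the restriction to \<open>good_pairs\<close>, which
  has full probability for the law of \<open>(l, w)\<close>.\<close>

definition set_at :: "'n \<Rightarrow> real \<Rightarrow> ('n \<Rightarrow> real) \<Rightarrow> real^'n" where
  "set_at x a w = (\<chi> y. if y = x then a else w y)"

definition resolvent :: "real^'n^'n \<Rightarrow> real \<Rightarrow> 'n \<Rightarrow> ('n \<Rightarrow> real) \<Rightarrow> real^'n^'n" where
  "resolvent T l x w = matrix_inv (ham T (set_at x 0 w) - mat l)"

definition good_pairs :: "real^'n^'n \<Rightarrow> 'n \<Rightarrow> (real \<times> ('n \<Rightarrow> real)) set" where
  "good_pairs T x = {(l, w). l \<in> {0..1} \<and> invertible (ham T (set_at x 0 w) - mat l)
      \<and> resolvent T l x w $ x $ x \<noteq> 0}"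

definition reconstruct :: "real^'n^'n \<Rightarrow> 'n \<Rightarrow> real \<times> ('n \<Rightarrow> real) \<Rightarrow> 'n::finite quad" where
  "reconstruct T x = (\<lambda>(l, w).
     let G = resolvent T l x w; g = G *v axis x 1
     in (set_at x (- 1 / (G $ x $ x)) w, l, (1 / norm g) *\<^sub>R g, x))"

definition mu2 :: "real^'n^'n \<Rightarrow> ('n::finite \<Rightarrow> real measure) \<Rightarrow> 'n quad measure" where
  "mu2 T \<rho> =
     uniform_count_measure UNIV \<bind> (\<lambda>x.
     distr (restrict_space (uniform_measure lborel {0..1} \<Otimes>\<^sub>M Pi\<^sub>M (UNIV - {x}) \<rho>)
              (good_pairs T x))
       Omega (reconstruct T x))"

end

theory Submission
  imports Defs
begin

text \<open>Fix a site \<open>x\<close> and the potential \<open>w\<close> off \<open>x\<close>, and let \<open>s(l) = (H - l)\<^sup>-\<^sup>1 1\<^sub>x\<close> where \<open>H\<close> has potential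
  \<open>0\<close> at \<open>x\<close>. The eigenvalues of \<open>H + a 1\<^sub>x 1\<^sub>x\<^sup>*\<close> whose eigenvector does not vanish at \<open>x\<close> are the
  solutions \<open>l\<close> of \<open>F(l) = a\<close> with \<open>F(l) = - 1 / s(l)\<^sub>x\<close>, and the eigenvector is \<open>s(l)\<close> up to scaling.
  By the resolvent identity \<open>F'(l) = |s(l)|\<^sup>2 / s(l)\<^sub>x\<^sup>2\<close>, which is \<open>1 / \<phi>(x)\<^sup>2\<close> for the unit eigenvector
  \<open>\<phi>\<close>. So the one-dimensional area formula for \<open>F\<close> turns the sum over eigenvalues weighted by
  \<open>\<phi>(x)\<^sup>2\<close>, integrated in \<open>a\<close> against \<open>\<rho> x\<close>, into an integral in \<open>l\<close> with density
  \<open>d\<rho>\<^sub>x/da\<close> at \<open>F(l)\<close>: this is \<open>mu1\<close> written as a density with respect to \<open>mu2\<close>. The factors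
  \<open>1 / CARD('n)\<close> agree because a nondegenerate symmetric matrix has \<open>CARD('n)\<close> eigenvalues.\<close>

section \<open>Spectra of symmetric matrices\<close>

text \<open>Two obstacles shape the proof. A \<open>bind\<close> has its intended meaning only for
  measurable kernels, whereas \<open>unit_eigvec\<close> is an arbitrary choice. Sets in
  \<open>Omega_sets\<close> do not see the sign of a vector. Where the eigenvector is nonzero at
  \<open>x\<close>, it is up to sign a normalized Cramer column, hence Borel in potential and
  energy; where it vanishes at \<open>x\<close>, its weight is 0. The eigenvalues then enter only
  through finite sums over the spectrum, and for these it suffices that the event of the spectrum
  meeting a compact interval is measurable. The second obstacle is that \<open>F\<close> increases
  on each interval of its domain but is in general not injective, so a plain substitution is not
  enough and the values must be counted with multiplicity. Two exceptional sets have to be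
  negligible: the coupling 0, which \<open>F\<close> never attains and which is a Lebesgue null set,
  and for each \<open>w\<close> the finitely many energies at which \<open>s\<close> is undefined or
  vanishes at \<open>x\<close>.\<close>

lemma symmetric_inner:
  fixes A :: "real^'n^'n"
  assumes "transpose A = A"
  shows "(A *v u) \<bullet> v = u \<bullet> (A *v v)"
  by (metis assms dot_lmul_matrix inner_commute vector_transpose_matrix)

text \<open>A maximizer \<open>u\<close> of the Rayleigh quotient on the unit sphere of
  \<open>W\<close> works: the first-order condition makes \<open>m *\<^sub>R u - A *v u\<close>
  orthogonal to \<open>W\<close>, and invariance puts this vector into \<open>W\<close>, so it is
  0.\<close>

lemma symmetric_eigenvector_in_invariant_subspace:
  fixes A :: "real^'n^'n"
  assumes sym: "transpose A = A" and W: "subspace W" and "z0 \<in> W" "z0 \<noteq> 0"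
    and inv: "\<And>u. u \<in> W \<Longrightarrow> A *v u \<in> W"
  shows "\<exists>m u. u \<in> W \<and> norm u = 1 \<and> A *v u = m *\<^sub>R u"
proof -
  have comp: "compact (W \<inter> sphere 0 1)"
    using W by (simp add: closed_Int_compact closed_subspace)
  have "(1 / norm z0) *\<^sub>R z0 \<in> W \<inter> sphere 0 1"
    using W assms(3,4) by (auto simp: subspace_scale)
  then have ne: "W \<inter> sphere 0 1 \<noteq> {}" by blast
  have "continuous_on (W \<inter> sphere 0 1) (\<lambda>u. u \<bullet> (A *v u))"
    by (intro continuous_intros matrix_vector_mult_linear_continuous_on)
  from continuous_attains_sup[OF comp ne this] obtain u where
    u: "u \<in> W" "norm u = 1" and max: "\<And>y. y \<in> W \<Longrightarrow> norm y = 1 \<Longrightarrow> y \<bullet> (A *v y) \<le> u \<bullet> (A *v u)"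
    by auto
  define m where "m = u \<bullet> (A *v u)"
  have bound: "z \<bullet> (A *v z) \<le> m * (z \<bullet> z)" if "z \<in> W" for z
  proof (cases "z = 0")
    case False
    let ?y = "(1 / norm z) *\<^sub>R z"
    have "?y \<bullet> (A *v ?y) \<le> m"
      unfolding m_def using that W False by (intro max) (auto simp: subspace_scale)
    moreover have "?y \<bullet> (A *v ?y) = (z \<bullet> (A *v z)) / (z \<bullet> z)"
      by (simp only: matrix_vector_mult_scaleR inner_scaleR_left inner_scaleR_right)
        (simp add: dot_square_norm power2_eq_square)
    moreover have "z \<bullet> z > 0" using False by simp
    ultimately show ?thesis using pos_divide_le_eq[of "z \<bullet> z" "z \<bullet> (A *v z)" m] by argo
  qed simp
  have orth: "(m *\<^sub>R u - A *v u) \<bullet> z = 0" if "z \<in> W" for z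
  proof -
    define b where "b = (m *\<^sub>R u - A *v u) \<bullet> z"
    define q where "q = m * (z \<bullet> z) - z \<bullet> (A *v z)"
    have uu: "u \<bullet> u = 1" using u(2) by (simp add: dot_square_norm)
    have Auz: "(A *v u) \<bullet> z = u \<bullet> (A *v z)" by (rule symmetric_inner[OF sym])
    \<comment> \<open>This is maximality of \<open>u\<close> tested at
      \<open>u + t *\<^sub>R z\<close>; the constant terms cancel, and a nonzero linear coefficient
      would violate the inequality for small \<open>t\<close>.\<close>
    have "0 \<le> 2 * t * b + t\<^sup>2 * q" for t
    proof -
      have "u + t *\<^sub>R z \<in> W" using W u(1) that by (simp add: subspace_add subspace_scale)
      from bound[OF this] have
        b: "(u + t *\<^sub>R z) \<bullet> (A *v (u + t *\<^sub>R z)) \<le> m * ((u + t *\<^sub>R z) \<bullet> (u + t *\<^sub>R z))" .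
      have zu: "z \<bullet> u = u \<bullet> z" by (simp only: inner_commute)
      have zAu: "z \<bullet> (A *v u) = u \<bullet> (A *v z)" using Auz by (simp only: inner_commute)
      have 1: "(u + t *\<^sub>R z) \<bullet> (A *v (u + t *\<^sub>R z)) = m + 2 * t * (u \<bullet> (A *v z)) + t\<^sup>2 * (z \<bullet> (A *v z))"
        by (simp only: matrix_vector_right_distrib matrix_vector_mult_scaleR inner_left_distrib
            inner_right_distrib inner_scaleR_left inner_scaleR_right zAu m_def power2_eq_square distrib_left)
      have 2: "(u + t *\<^sub>R z) \<bullet> (u + t *\<^sub>R z) = 1 + 2 * t * (u \<bullet> z) + t\<^sup>2 * (z \<bullet> z)"
        by (simp only: inner_left_distrib inner_right_distrib
            inner_scaleR_left inner_scaleR_right zu uu power2_eq_square distrib_left)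
      show ?thesis
        using b unfolding b_def q_def 1 2 inner_diff_left Auz inner_scaleR_left by argo
    qed
    note Q = this
    have q0: "q \<ge> 0" using bound[OF that] by (simp add: q_def)
    have "b = 0"
    proof (rule ccontr)
      assume "b \<noteq> 0"
      \<comment> \<open>The denominator \<open>q + 1\<close> instead of \<open>q\<close> also covers
        q = 0; the quadratic then takes the negative value
        \<open>- (t\<^sup>2 * (q + 2))\<close>.\<close>
      define t where "t = - b / (q + 1)"
      have b: "b = - t * (q + 1)" using q0 by (simp add: t_def)
      have "t \<noteq> 0" using \<open>b \<noteq> 0\<close> b by auto
      have "0 \<le> 2 * t * b + t\<^sup>2 * q" by (rule Q)
      also have "\<dots> = - (t\<^sup>2 * (q + 2))"
        by (simp add: b algebra_simps power2_eq_square)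
      also have "\<dots> < 0" using q0 \<open>t \<noteq> 0\<close> by simp
      finally show False by simp
    qed
    then show ?thesis by (simp add: b_def)
  qed
  have "m *\<^sub>R u - A *v u \<in> W" using W u inv by (simp add: subspace_diff subspace_scale)
  from orth[OF this] have "m *\<^sub>R u - A *v u = 0" by (simp only: inner_eq_zero_iff)
  then have "A *v u = m *\<^sub>R u" by (simp only: right_minus_eq)
  with u show ?thesis by blast
qed

lemma symmetric_eigenvectors_orthogonal:
  fixes A :: "real^'n^'n"
  assumes "transpose A = A" "A *v u = l *\<^sub>R u" "A *v v = m *\<^sub>R v" "l \<noteq> m"
  shows "u \<bullet> v = 0"
proof -
  have "l * (u \<bullet> v) = m * (u \<bullet> v)"
    using symmetric_inner[OF assms(1), of u v] unfolding assms(2,3) inner_scaleR_left inner_scaleR_right .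
  then show ?thesis using assms(4) by simp
qed

lemma specI: "u \<noteq> 0 \<Longrightarrow> A *v u = l *\<^sub>R u \<Longrightarrow> l \<in> spec A"
  by (auto simp: spec_def)

lemma unit_eigvec:
  assumes "l \<in> spec A"
  shows "norm (unit_eigvec A l) = 1" "A *v unit_eigvec A l = l *\<^sub>R unit_eigvec A l"
proof -
  obtain u where "u \<noteq> 0" "A *v u = l *\<^sub>R u" using assms by (auto simp: spec_def)
  then have "norm ((1 / norm u) *\<^sub>R u) = 1 \<and> A *v ((1 / norm u) *\<^sub>R u) = l *\<^sub>R ((1 / norm u) *\<^sub>R u)"
    by (simp add: matrix_vector_mult_scaleR)
  then have "norm (unit_eigvec A l) = 1 \<and> A *v unit_eigvec A l = l *\<^sub>R unit_eigvec A l"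
    unfolding unit_eigvec_def by (rule someI)
  then show "norm (unit_eigvec A l) = 1" "A *v unit_eigvec A l = l *\<^sub>R unit_eigvec A l" by auto
qed

lemma unit_eigvecs_independent:
  fixes A :: "real^'n^'n"
  assumes sym: "transpose A = A"
  shows "inj_on (unit_eigvec A) (spec A)" "independent (unit_eigvec A ` spec A)"
proof -
  have orth: "unit_eigvec A l \<bullet> unit_eigvec A m = 0" if "l \<in> spec A" "m \<in> spec A" "l \<noteq> m" for l m
    using symmetric_eigenvectors_orthogonal[OF sym unit_eigvec(2)[OF that(1)] unit_eigvec(2)[OF that(2)] that(3)] .
  show "inj_on (unit_eigvec A) (spec A)"
  proof (rule inj_onI, rule ccontr)
    fix l m assume *: "l \<in> spec A" "m \<in> spec A" "unit_eigvec A l = unit_eigvec A m" "l \<noteq> m"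
    then show False using orth[OF *(1,2,4)] unit_eigvec(1)[OF *(2)] by auto
  qed
  show "independent (unit_eigvec A ` spec A)"
  proof (rule pairwise_orthogonal_independent)
    show "pairwise orthogonal (unit_eigvec A ` spec A)"
      using orth by (force simp: pairwise_def orthogonal_def)
    show "0 \<notin> unit_eigvec A ` spec A" using unit_eigvec(1)[of _ A] by force
  qed
qed

lemma finite_spec:
  fixes A :: "real^'n^'n"
  assumes "transpose A = A"
  shows "finite (spec A)"
  using unit_eigvecs_independent[OF assms] by (meson finite_imageD independent_imp_finite)

lemma nondegenerate_eigenvector_unique:
  fixes A :: "real^'n^'n"
  assumes "nondegenerate A" "A *v u = l *\<^sub>R u" "A *v p = l *\<^sub>R p" "p \<noteq> 0"
  shows "\<exists>c. u = c *\<^sub>R p"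
proof -
  have "l \<in> spec A" using assms by (auto simp: spec_def)
  then have d: "dim {u. A *v u = l *\<^sub>R u} = 1" using assms(1) by (auto simp: nondegenerate_def)
  have "{u. A *v u = l *\<^sub>R u} \<subseteq> span {p}"
    by (rule card_ge_dim_independent) (use assms d in auto)
  then have "u \<in> span {p}" using assms by blast
  then show ?thesis by (auto simp: span_singleton)
qed

text \<open>The orthogonal complement of the chosen unit eigenvectors is invariant. If it were
  nonzero it would contain another eigenvector, which by simplicity is a multiple of a chosen one
  and hence orthogonal to itself.\<close>

lemma card_spec_nondegenerate:
  fixes A :: "real^'n^'n"
  assumes sym: "transpose A = A" and nd: "nondegenerate A"
  shows "card (spec A) = CARD('n)"
proof -
  let ?B = "unit_eigvec A ` spec A"
  define W where "W = {z. \<forall>b\<in>?B. b \<bullet> z = 0}"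
  have W: "subspace W"
    by (auto simp: W_def subspace_def inner_right_distrib)
  have inv: "A *v z \<in> W" if "z \<in> W" for z
    using that by (auto simp: W_def symmetric_inner[OF sym, symmetric] unit_eigvec)
  have "span ?B = UNIV"
  proof (rule ccontr)
    assume "span ?B \<noteq> UNIV"
    then have "span ?B \<subset> span (UNIV :: (real^'n) set)" by auto
    then obtain z where z: "z \<noteq> 0" "\<And>y. y \<in> span ?B \<Longrightarrow> orthogonal z y"
      using orthogonal_to_subspace_exists_gen by metis
    have "b \<bullet> z = 0" if "b \<in> ?B" for b
      using z(2)[OF span_base[OF that]] by (simp only: orthogonal_def inner_commute)
    then have "z \<in> W" unfolding W_def by blast
    from symmetric_eigenvector_in_invariant_subspace[OF sym W this z(1) inv]
    obtain m u where u: "u \<in> W" "norm u = 1" "A *v u = m *\<^sub>R u" by blast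
    then have m: "m \<in> spec A" by (intro specI[of u]) auto
    obtain c where c: "u = c *\<^sub>R unit_eigvec A m"
      using nondegenerate_eigenvector_unique[OF nd u(3) unit_eigvec(2)[OF m]] unit_eigvec(1)[OF m] by force
    have "unit_eigvec A m \<bullet> u = 0" using u(1) m by (auto simp: W_def)
    then have "u \<bullet> u = 0" by (subst (1) c) simp
    then show False using u(2) by auto
  qed
  then have "dim (UNIV :: (real^'n) set) = card ?B"
    using unit_eigvecs_independent(2)[OF sym] by (intro dim_eq_card) simp_all
  moreover have "card ?B = card (spec A)"
    using unit_eigvecs_independent(1)[OF sym] by (rule card_image)
  ultimately show ?thesis by simp
qed

section \<open>Measurability of spectral conditions on the potential\<close>

lemma transpose_ham:
  assumes "transpose T = T"
  shows "transpose (ham T v) = ham T v"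
  using assms by (auto simp: ham_def transpose_def diag_mat_def vec_eq_iff)

lemma diag_mat_mult: "diag_mat v *v u = (\<chi> i. v $ i * u $ i)"
  by (simp add: diag_mat_def matrix_vector_mult_def vec_eq_iff if_distrib if_distribR cong: if_cong)

lemma ham_mult_nth: "(ham T v *v u) $ i = (T *v u) $ i + v $ i * u $ i"
  by (simp add: ham_def matrix_vector_mult_add_rdistrib diag_mat_mult)

lemma ham_mult: "ham T v *v u = T *v u + (\<chi> i. v $ i * u $ i)"
  by (simp add: vec_eq_iff ham_mult_nth)

lemma mat_mult_vec: "mat l *v u = l *\<^sub>R (u :: real^'n)"
  by (simp add: mat_def matrix_vector_mult_def vec_eq_iff if_distrib if_distribR cong: if_cong)

text \<open>The eigenvalue equation is a closed relation between \<open>v\<close> and the pair of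
  energy and unit vector; projecting away a compact set of such pairs preserves closedness. All
  measurable dependence of the spectrum on \<open>v\<close> is drawn from this fact.\<close>

lemma closed_spec_meets:
  fixes T :: "real^'n^'n"
  shows "closed {v. spec (ham T v) \<inter> {r..a} \<noteq> {}}"
proof -
  define C where "C = {((l, u), v). ham T v *v u = l *\<^sub>R (u :: real^'n)}"
  have cl: "closed C"
    unfolding C_def ham_mult case_prod_beta
    by (intro closed_Collect_eq continuous_intros) (auto intro!: continuous_intros simp: matrix_vector_mult_def)
  have "closed {v. \<exists>p. p \<in> {r..a} \<times> sphere 0 1 \<and> (p, v) \<in> C}"
    by (rule closed_compact_projection[OF _ cl]) (auto intro: compact_Times)
  also have "{v. \<exists>p. p \<in> {r..a} \<times> sphere 0 1 \<and> (p, v) \<in> C} = {v. spec (ham T v) \<inter> {r..a} \<noteq> {}}"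
  proof (intro equalityI subsetI)
    fix v assume "v \<in> {v. \<exists>p. p \<in> {r..a} \<times> sphere 0 1 \<and> (p, v) \<in> C}"
    then obtain l u where "((l, u), v) \<in> C" "norm u = 1" "l \<in> {r..a}" by auto
    then have "l \<in> spec (ham T v) \<inter> {r..a}" by (auto simp: C_def spec_def intro!: exI[of _ u])
    then show "v \<in> {v. spec (ham T v) \<inter> {r..a} \<noteq> {}}" by blast
  next
    fix v assume "v \<in> {v. spec (ham T v) \<inter> {r..a} \<noteq> {}}"
    then obtain l where "l \<in> spec (ham T v)" "l \<in> {r..a}" by blast
    then have "(l, unit_eigvec (ham T v) l) \<in> {r..a} \<times> sphere 0 1
        \<and> ((l, unit_eigvec (ham T v) l), v) \<in> C"
      by (simp add: C_def unit_eigvec)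
    then show "v \<in> {v. \<exists>p. p \<in> {r..a} \<times> sphere 0 1 \<and> (p, v) \<in> C}" by blast
  qed
  finally show ?thesis .
qed

text \<open>Replaces a dimension by an existential statement over unit vectors, so that the
  projection argument along compact sets becomes available.\<close>

lemma nondegenerate_iff_no_orthonormal_pair:
  fixes A :: "real^'n^'n"
  shows "nondegenerate A \<longleftrightarrow>
    \<not> (\<exists>l u w. norm u = 1 \<and> norm w = 1 \<and> u \<bullet> w = 0 \<and> A *v u = l *\<^sub>R u \<and> A *v w = l *\<^sub>R w)"
    (is "_ \<longleftrightarrow> \<not> ?P")
proof
  assume nd: "nondegenerate A"
  show "\<not> ?P"
  proof
    assume ?P
    then obtain l u w where *: "norm u = 1" "norm w = 1" "u \<bullet> w = 0" "A *v u = l *\<^sub>R u" "A *v w = l *\<^sub>R w"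
      by blast
    then obtain c where "u = c *\<^sub>R w"
      using nondegenerate_eigenvector_unique[OF nd *(4,5)] by force
    then show False using * by (auto simp: dot_square_norm)
  qed
next
  assume P: "\<not> ?P"
  show "nondegenerate A"
    unfolding nondegenerate_def
  proof
    fix l assume l: "l \<in> spec A"
    let ?E = "{u. A *v u = l *\<^sub>R u}"
    have "subspace ?E"
      by (auto simp: subspace_def matrix_vector_right_distrib matrix_vector_mult_scaleR algebra_simps)
    then obtain B where B: "B \<subseteq> ?E" "pairwise orthogonal B" "\<And>x. x \<in> B \<Longrightarrow> norm x = 1"
      "independent B" "card B = dim ?E" "span B = ?E"
      by (rule orthonormal_basis_subspace) blast
    have "card B \<le> 1"
    proof (rule ccontr)
      assume "\<not> card B \<le> 1"
      then have "\<exists>u\<in>B. \<exists>w\<in>B. u \<noteq> w"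
        by (metis card_le_Suc0_iff_eq One_nat_def card.infinite zero_le)
      then obtain u w where uw: "u \<in> B" "w \<in> B" "u \<noteq> w" by blast
      then have "orthogonal u w" using B(2) by (simp add: pairwiseD)
      then show False
        using P B(3)[OF uw(1)] B(3)[OF uw(2)] subsetD[OF B(1) uw(1)] subsetD[OF B(1) uw(2)]
        unfolding orthogonal_def mem_Collect_eq by blast
    qed
    moreover have "card B \<noteq> 0"
    proof
      assume "card B = 0"
      then have "B = {}" using B(4) independent_imp_finite by fastforce
      then have "?E = {0}" using B(6) by simp
      then show False using l by (auto simp: spec_def)
    qed
    ultimately show "dim ?E = 1" using B(5) by linarith
  qed
qed

text \<open>The degenerate potentials with a witness energy in \<open>{- real n..real n}\<close>
  form a closed set for every \<open>n\<close>, so the degenerate ones form a countable union of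
  closed sets.\<close>

lemma sets_nondegenerate:
  fixes T :: "real^'n^'n"
  shows "{v. nondegenerate (ham T v)} \<in> sets borel"
proof -
  define C where "C = {((l, u, w), v). ham T v *v u = l *\<^sub>R (u :: real^'n) \<and> ham T v *v w = l *\<^sub>R (w :: real^'n)
     \<and> u \<bullet> w = 0}"
  have cl: "closed C"
    unfolding C_def ham_mult case_prod_beta
    by (intro closed_Collect_eq closed_Collect_conj continuous_intros) (auto intro!: continuous_intros simp: matrix_vector_mult_def)
  have D: "closed {v. \<exists>p. p \<in> {- real n..real n} \<times> sphere 0 1 \<times> sphere 0 1 \<and> (p, v) \<in> C}" for n
    by (rule closed_compact_projection[OF _ cl]) (auto intro!: compact_Times)
  have "{v. nondegenerate (ham T v)} =
     - (\<Union>n. {v. \<exists>p. p \<in> {- real n..real n} \<times> sphere 0 1 \<times> sphere 0 1 \<and> (p, v) \<in> C})"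
  proof -
    have bd: "\<exists>n. l \<in> {- real n..real n}" for l
    proof -
      obtain n where "\<bar>l\<bar> \<le> real n" using real_arch_simple by blast
      then show ?thesis by (intro exI[of _ n]) auto
    qed
    have "(\<exists>l u w. norm u = 1 \<and> norm w = 1 \<and> u \<bullet> w = 0 \<and> ham T v *v u = l *\<^sub>R u \<and> ham T v *v w = l *\<^sub>R w)
      \<longleftrightarrow> (\<exists>n p. p \<in> {- real n..real n} \<times> sphere 0 1 \<times> sphere 0 1 \<and> (p, v) \<in> C)" (is "?l \<longleftrightarrow> ?r") for v
    proof
      assume ?l
      then obtain l u w where *: "norm u = 1" "norm w = 1" "((l, u, w), v) \<in> C" by (auto simp: C_def)
      moreover obtain n where "l \<in> {- real n..real n}" using bd by blast
      ultimately have "(l, u, w) \<in> {- real n..real n} \<times> sphere 0 1 \<times> sphere 0 1 \<and> ((l, u, w), v) \<in> C" by simp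
      then show ?r by blast
    next
      assume ?r
      then obtain l u w where "norm u = 1" "norm w = 1" "((l, u, w), v) \<in> C" by auto
      then show ?l by (auto simp: C_def)
    qed
    then show ?thesis
      unfolding nondegenerate_iff_no_orthonormal_pair by (simp add: set_eq_iff)
  qed
  also have "\<dots> \<in> sets borel" using D by (intro borel_comp sets.countable_UN) auto
  finally show ?thesis .
qed

text \<open>The complement of \<open>{0..1}\<close> is exhausted by countably many compact
  intervals, and for each of them the potentials whose spectrum meets it form a closed set.\<close>

lemma sets_good_potentials:
  fixes T :: "real^'n^'n"
  shows "good_potentials T \<in> sets borel"
proof -
  let ?S = "\<lambda>v. spec (ham T v)"
  have up: "\<exists>n. 1 + 1 / Suc n \<le> l \<and> l \<le> real n" if l: "l > 1" for l :: real
  proof -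
    obtain n where n: "1 / real (Suc n) < l - 1"
      using reals_Archimedean[of "l - 1"] l by (auto simp: inverse_eq_divide simp del: of_nat_Suc)
    obtain m where m: "l \<le> real m" using real_arch_simple by blast
    have "1 / real (Suc (max n m)) \<le> 1 / real (Suc n)" by (intro divide_left_mono) auto
    moreover have "l \<le> real (max n m)" using m by (simp add: of_nat_max)
    ultimately show ?thesis using n by (intro exI[of _ "max n m"] conjI) linarith+
  qed
  have down: "\<exists>n. - real n \<le> l \<and> l \<le> - (1 / Suc n)" if l: "l < 0" for l :: real
  proof -
    obtain n where "1 + 1 / Suc n \<le> 1 - l" "1 - l \<le> real n" using up[of "1 - l"] l by auto
    then show ?thesis by (intro exI[of _ n]) linarith
  qed
  have spec: "?S v \<subseteq> {0..1} \<longleftrightarrow>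
      (\<forall>n. ?S v \<inter> {1 + 1 / Suc n..real n} = {}) \<and> (\<forall>n. ?S v \<inter> {- real n..- (1 / Suc n)} = {})"
    (is "_ \<longleftrightarrow> ?r") for v
  proof (intro iffI conjI allI subsetI)
    fix n assume S: "?S v \<subseteq> {0..1}"
    have pos: "1 / real (Suc n) > 0" by simp
    have "\<not> (1 + 1 / Suc n \<le> l)" "\<not> (l \<le> - (1 / Suc n))" if "l \<in> ?S v" for l
      using subsetD[OF S that] pos unfolding atLeastAtMost_iff by linarith+
    then show "?S v \<inter> {1 + 1 / Suc n..real n} = {}" "?S v \<inter> {- real n..- (1 / Suc n)} = {}"
      unfolding disjoint_iff atLeastAtMost_iff by blast+
  next
    fix l assume r: ?r and l: "l \<in> ?S v"
    have "\<not> l > 1" using up[of l] r l unfolding disjoint_iff atLeastAtMost_iff by blast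
    moreover have "\<not> l < 0" using down[of l] r l unfolding disjoint_iff atLeastAtMost_iff by blast
    ultimately show "l \<in> {0..1}" by simp
  qed
  have "good_potentials T = {v. nondegenerate (ham T v)}
     - (\<Union>n. {v. ?S v \<inter> {1 + 1 / Suc n..real n} \<noteq> {}})
     - (\<Union>n. {v. ?S v \<inter> {- real n..- (1 / Suc n)} \<noteq> {}})"
    unfolding good_potentials_def spec by blast
  also have "\<dots> \<in> sets borel"
    using sets_nondegenerate[of T] closed_spec_meets[of T]
    by (intro sets.Diff sets.countable_UN image_subsetI) auto
  finally show ?thesis .
qed

section \<open>Measurable sums over finite sections\<close>

text \<open>By induction on \<open>N\<close>, splitting off the least point of each section, which depends measurably
  on \<open>v\<close>.\<close>

lemma borel_measurable_sum_finite_sections: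
  fixes S :: "'a \<Rightarrow> real set" and g :: "'a \<times> real \<Rightarrow> ennreal"
  assumes "\<And>v. v \<in> space M \<Longrightarrow> finite (S v)" "\<And>v. v \<in> space M \<Longrightarrow> card (S v) \<le> N"
    and "\<And>r a. {v \<in> space M. S v \<inter> {r..a} \<noteq> {}} \<in> sets M"
    and g[measurable]: "g \<in> borel_measurable (M \<Otimes>\<^sub>M borel)"
  shows "(\<lambda>v. \<Sum>l\<in>S v. g (v, l)) \<in> borel_measurable M"
  using assms(1-3)
proof (induction N arbitrary: S)
  case 0
  then have "S v = {}" if "v \<in> space M" for v using that by fastforce
  then have "(\<lambda>v. \<Sum>l\<in>S v. g (v, l)) \<in> borel_measurable M \<longleftrightarrow> (\<lambda>v. 0::ennreal) \<in> borel_measurable M"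
    by (intro measurable_cong) simp
  then show ?case by simp
next
  case (Suc N)
  note fin = Suc.prems(1) and meets[measurable] = Suc.prems(3)
  define E where "E = {v \<in> space M. S v \<noteq> {}}"
  define m where "m v = (if S v = {} then 0 else Min (S v))" for v
  have "E = (\<Union>n::nat. {v \<in> space M. S v \<inter> {- real n..real n} \<noteq> {}})"
  proof -
    have "\<exists>n::nat. l \<in> {- real n..real n}" for l
    proof -
      obtain n :: nat where "\<bar>l\<bar> \<le> real n" using real_arch_simple by blast
      then show ?thesis by (intro exI[of _ n]) auto
    qed
    then show ?thesis unfolding E_def by blast
  qed
  then have E[measurable]: "E \<in> sets M" by simp
  have m_in: "m v \<in> S v" and m_le: "\<And>l. l \<in> S v \<Longrightarrow> m v \<le> l" if "v \<in> E" for v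
    using that fin[of v] by (auto simp: E_def m_def)
  have m[measurable]: "m \<in> borel_measurable M"
  proof (subst borel_measurable_iff_le, rule allI)
    fix a :: real
    have low: "\<exists>n::nat. - real n \<le> l" for l
      using real_arch_simple[of "-l"] by (metis minus_le_iff)
    \<comment> \<open>The least point is at most \<open>a\<close> exactly if the section meets some
      \<open>{- real n..a}\<close>; an empty section has the default 0 and so counts only when 0
      \<le> \<open>a\<close>.\<close>
    have "{v \<in> space M. m v \<le> a} = (\<Union>n::nat. {v \<in> space M. S v \<inter> {- real n..a} \<noteq> {}})
        \<union> (if 0 \<le> a then space M - E else {})" (is "?L = ?R")
    proof (intro equalityI subsetI)
      fix v assume v: "v \<in> ?L"
      show "v \<in> ?R"
      proof (cases "v \<in> E")
        case True
        obtain n :: nat where "- real n \<le> m v" using low by blast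
        then have "m v \<in> S v \<inter> {- real n..a}" using m_in[OF True] v by simp
        then show ?thesis using v by blast
      next
        case False
        then have "m v = 0" using v by (simp add: E_def m_def)
        then show ?thesis using v False by simp
      qed
    next
      fix v assume v: "v \<in> ?R"
      show "v \<in> ?L"
      proof (cases "v \<in> E")
        case True
        then obtain l where "l \<in> S v" "l \<le> a" using v by (auto split: if_splits)
        then show ?thesis using m_le[OF True, of l] True by (simp add: E_def)
      next
        case False
        then show ?thesis using v by (auto simp: E_def m_def split: if_splits)
      qed
    qed
    also have "\<dots> \<in> sets M" by simp
    finally show "?L \<in> sets M" .
  qed
  define S' where "S' v = S v - {m v}" for v
  have "(\<lambda>v. \<Sum>l\<in>S' v. g (v, l)) \<in> borel_measurable M"
  proof (rule Suc.IH)
    fix v assume v: "v \<in> space M"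
    show "finite (S' v)" using fin[OF v] by (simp add: S'_def)
    show "card (S' v) \<le> N"
    proof (cases "v \<in> E")
      case True
      then show ?thesis using Suc.prems(2)[OF v] m_in[OF True] fin[OF v] by (simp add: S'_def)
    next
      case False
      then show ?thesis using v by (simp add: E_def S'_def)
    qed
  next
    fix r a :: real
    \<comment> \<open>A point of the section other than the minimum is separated from it by a
      rational \<open>q\<close>, which turns the removal of one point into countably many conditions
      on \<open>S\<close> and \<open>m\<close>.\<close>
    have "{v \<in> space M. S' v \<inter> {r..a} \<noteq> {}} =
      (\<Union>q\<in>\<rat>. {v \<in> space M. m v < q} \<inter> {v \<in> space M. S v \<inter> {max q r..a} \<noteq> {}})" (is "?L = ?R")
    proof (intro equalityI subsetI)
      fix v assume "v \<in> ?L"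
      then obtain l where l: "v \<in> space M" "l \<in> S v" "l \<noteq> m v" "r \<le> l" "l \<le> a"
        unfolding S'_def disjoint_iff by fastforce
      then have "v \<in> E" by (auto simp: E_def)
      then have "m v < l" using m_le[of v l] l by simp
      then obtain q where q: "q \<in> \<rat>" "m v < q" "q < l" using Rats_dense_in_real by blast
      then have "l \<in> S v \<inter> {max q r..a}" using l by simp
      then show "v \<in> ?R" using l q by blast
    next
      fix v assume "v \<in> ?R"
      then obtain q l where "v \<in> space M" "m v < q" "l \<in> S v" "q \<le> l" "r \<le> l" "l \<le> a" by auto
      then have "l \<in> S' v \<inter> {r..a}" by (simp add: S'_def)
      then show "v \<in> ?L" using \<open>v \<in> space M\<close> by blast
    qed
    also have "\<dots> \<in> sets M" by (intro sets.countable_UN' countable_rat image_subsetI sets.Int) measurable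
    finally show "?L \<in> sets M" .
  qed
  then have "(\<lambda>v. indicator E v * g (v, m v) + (\<Sum>l\<in>S' v. g (v, l))) \<in> borel_measurable M"
    by simp
  also have "?this \<longleftrightarrow> ?case"
  proof (rule measurable_cong)
    fix v assume v: "v \<in> space M"
    show "indicator E v * g (v, m v) + (\<Sum>l\<in>S' v. g (v, l)) = (\<Sum>l\<in>S v. g (v, l))"
    proof (cases "v \<in> E")
      case True
      then show ?thesis using sum.remove[OF fin[OF v] m_in[OF True], of "\<lambda>l. g (v, l)"] by (simp add: S'_def)
    next
      case False
      then show ?thesis using v by (simp add: E_def S'_def)
    qed
  qed
  finally show ?case .
qed

section \<open>The area formula on the line\<close>

text \<open>Here \<open>F\<close> is injective, so each fibre has at most one point and the claim is
  the substitution rule for the inverse function. The Borel set \<open>S\<close> is kept general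
  because the area formula will cut intervals into disjoint pieces that need not be
  intervals.\<close>

lemma nn_integral_increasing_piece:
  fixes F F' :: "real \<Rightarrow> real" and g :: "real \<Rightarrow> ennreal"
  assumes "p < q"
    and der: "\<And>l. l \<in> {p..q} \<Longrightarrow> (F has_real_derivative F' l) (at l)"
    and cont: "continuous_on {p..q} F'" and pos: "\<And>l. l \<in> {p..q} \<Longrightarrow> F' l > 0"
    and S[measurable]: "S \<in> sets borel" and "S \<subseteq> {p..q}"
    and g[measurable]: "g \<in> borel_measurable borel"
  shows "(\<lambda>a. \<Sum>l | l \<in> S \<and> F l = a. g l / ennreal (F' l)) \<in> borel_measurable borel"
    and "(\<integral>\<^sup>+l. indicator S l * g l \<partial>lborel) = (\<integral>\<^sup>+a. (\<Sum>l | l \<in> S \<and> F l = a. g l / ennreal (F' l)) \<partial>lborel)"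
proof -
  have mono: "F x < F y" if "x \<in> {p..q}" "y \<in> {p..q}" "x < y" for x y
    using that by (intro DERIV_pos_imp_increasing[of x y F]) (auto intro!: exI der pos)
  have inj: "inj_on F {p..q}"
  proof (rule inj_onI, rule ccontr)
    fix x y assume "x \<in> {p..q}" "y \<in> {p..q}" "F x = F y" "x \<noteq> y"
    then show False using mono[of x y] mono[of y x] by (cases "x < y") auto
  qed
  have contF: "continuous_on {p..q} F"
    using der by (rule has_real_derivative_imp_continuous_on)
  have im: "F ` {p..q} = {F p..F q}"
  proof (intro equalityI subsetI)
    fix a assume "a \<in> F ` {p..q}"
    then obtain l where l: "l \<in> {p..q}" "a = F l" by blast
    then show "a \<in> {F p..F q}"
      using mono[of p l] mono[of l q] \<open>p < q\<close> by (cases "l = p"; cases "l = q") auto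
  next
    fix a assume "a \<in> {F p..F q}"
    then obtain l where "p \<le> l" "l \<le> q" "F l = a"
      using IVT'[of F p a q] contF \<open>p < q\<close> by auto
    then show "a \<in> F ` {p..q}" by auto
  qed
  define h where "h = inv_into {p..q} F"
  have hF: "h (F l) = l" if "l \<in> {p..q}" for l using inj that by (simp add: h_def)
  have h_in: "h a \<in> {p..q}" and Fh: "F (h a) = a" if "a \<in> {F p..F q}" for a
    using that unfolding im[symmetric] h_def by (rule inv_into_into, rule f_inv_into_f)
  have conth: "continuous_on {F p..F q} h"
    unfolding im[symmetric] by (rule continuous_on_inv[OF contF]) (auto simp: hF)
  have contk: "continuous_on {F p..F q} (\<lambda>a. F' (h a))"
    by (rule continuous_on_compose2[OF cont conth]) (use h_in in auto)
  \<comment> \<open>Constant values outside the image give functions that are Borel on the whole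
    line; the indicator of the image in \<open>f\<close> makes these values irrelevant.\<close>
  define h0 where "h0 a = (if a \<in> {F p..F q} then h a else p)" for a
  define k where "k a = (if a \<in> {F p..F q} then F' (h a) else 1)" for a
  have [measurable]: "h0 \<in> borel_measurable borel" "k \<in> borel_measurable borel"
    unfolding h0_def k_def by (intro borel_measurable_continuous_on_if conth contk; simp)+
  define f where "f a = indicator S (h0 a) * g (h0 a) / ennreal (k a) * indicator {F p..F q} a" for a
  have f[measurable]: "f \<in> borel_measurable borel" unfolding f_def by measurable
  have f_eq: "(\<Sum>l | l \<in> S \<and> F l = a. g l / ennreal (F' l)) = f a" for a
  proof (cases "a \<in> {F p..F q} \<and> h a \<in> S")
    case True
    then have "{l. l \<in> S \<and> F l = a} = {h a}" using \<open>S \<subseteq> {p..q}\<close> hF Fh by auto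
    then show ?thesis using True by (simp add: f_def h0_def k_def)
  next
    case False
    have "a \<in> {F p..F q} \<and> h a \<in> S" if "l \<in> S" "F l = a" for l
    proof -
      have l: "l \<in> {p..q}" using that(1) \<open>S \<subseteq> {p..q}\<close> by (rule rev_subsetD)
      have "F l \<in> F ` {p..q}" using l by (rule imageI)
      then show ?thesis using hF[OF l] that unfolding im by simp
    qed
    then have e: "{l. l \<in> S \<and> F l = a} = {}" using False by blast
    have "f a = 0" using False by (auto simp: f_def h0_def)
    then show ?thesis unfolding e by simp
  qed
  show "(\<lambda>a. \<Sum>l | l \<in> S \<and> F l = a. g l / ennreal (F' l)) \<in> borel_measurable borel"
    unfolding f_eq by measurable
  have "(\<integral>\<^sup>+a. f a \<partial>lborel) = (\<integral>\<^sup>+a. f a * indicator {F p..F q} a \<partial>lborel)"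
    by (intro nn_integral_cong) (simp add: f_def split: split_indicator)
  also have "\<dots> = (\<integral>\<^sup>+l. f (F l) * ennreal (F' l) * indicator {p..q} l \<partial>lborel)"
    using f der cont pos \<open>p < q\<close> by (intro nn_integral_substitution_aux) (auto simp: less_imp_le)
  also have "\<dots> = (\<integral>\<^sup>+l. indicator S l * g l \<partial>lborel)"
  proof (rule nn_integral_cong)
    fix l
    show "f (F l) * ennreal (F' l) * indicator {p..q} l = indicator S l * g l"
    proof (cases "l \<in> {p..q}")
      case True
      then have "F l \<in> {F p..F q}" using im by blast
      then have "f (F l) = indicator S l * g l / ennreal (F' l)"
        by (simp add: f_def h0_def k_def hF[OF True])
      then show ?thesis using True pos[OF True]
        by (simp add: ennreal_divide_times ennreal_mult_divide_eq)
    next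
      case False
      then show ?thesis using \<open>S \<subseteq> {p..q}\<close> by (auto split: split_indicator)
    qed
  qed
  finally show "(\<integral>\<^sup>+l. indicator S l * g l \<partial>lborel) = (\<integral>\<^sup>+a. (\<Sum>l | l \<in> S \<and> F l = a. g l / ennreal (F' l)) \<partial>lborel)"
    unfolding f_eq by simp
qed

text \<open>Rational compact intervals inside \<open>D\<close> give a countable cover on whose
  members \<open>F\<close> is strictly increasing. Finiteness of the fibres matters because a sum
  over an infinite set would default to 0.\<close>

lemma nn_integral_area_formula:
  fixes F F' :: "real \<Rightarrow> real" and g :: "real \<Rightarrow> ennreal"
  assumes "open D"
    and der: "\<And>l. l \<in> D \<Longrightarrow> (F has_real_derivative F' l) (at l)"
    and cont: "continuous_on D F'" and pos: "\<And>l. l \<in> D \<Longrightarrow> F' l > 0"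
    and fin: "\<And>a. finite {l \<in> D. F l = a}"
    and g[measurable]: "g \<in> borel_measurable borel"
  shows "(\<integral>\<^sup>+l. indicator D l * g l \<partial>lborel) =
    (\<integral>\<^sup>+a. (\<Sum>l | l \<in> D \<and> F l = a. g l / ennreal (F' l)) \<partial>lborel)"
proof (cases "D = {}")
  case False
  define C where "C = {(p, q). p \<in> \<rat> \<and> q \<in> \<rat> \<and> p < q \<and> {p..q} \<subseteq> D}"
  have "C \<subseteq> \<rat> \<times> \<rat>" by (auto simp: C_def)
  then have C: "countable C" by (rule countable_subset) (simp add: countable_rat)
  have cover: "\<exists>p q. (p, q) \<in> C \<and> l \<in> {p..q}" if l: "l \<in> D" for l
  proof -
    obtain e where e: "e > 0" "cball l e \<subseteq> D" using \<open>open D\<close> l open_contains_cball by blast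
    obtain p where p: "p \<in> \<rat>" "l - e < p" "p < l" using Rats_dense_in_real[of "l - e" l] e by auto
    obtain q where q: "q \<in> \<rat>" "l < q" "q < l + e" using Rats_dense_in_real[of l "l + e"] e by auto
    have "{p..q} \<subseteq> cball l e" using p q by (auto simp: dist_real_def)
    then show ?thesis using p q e by (intro exI[of _ p] exI[of _ q]) (auto simp: C_def)
  qed
  have ne: "C \<noteq> {}" using cover False by blast
  define P where "P n = fst (from_nat_into C n)" for n
  define Q where "Q n = snd (from_nat_into C n)" for n
  have PQ: "P n < Q n" "{P n..Q n} \<subseteq> D" for n
    using from_nat_into[OF ne, of n] by (auto simp: C_def P_def Q_def)
  have UN: "(\<Union>n. {P n..Q n}) = D"
  proof
    show "D \<subseteq> (\<Union>n. {P n..Q n})"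
    proof
      fix l assume "l \<in> D"
      then obtain p q where "(p, q) \<in> C" "l \<in> {p..q}" using cover by blast
      then obtain n where "from_nat_into C n = (p, q)" using from_nat_into_surj[OF C] by blast
      then show "l \<in> (\<Union>n. {P n..Q n})" using \<open>l \<in> {p..q}\<close> by (intro UN_I[of n]) (auto simp: P_def Q_def)
    qed
  qed (use PQ in blast)
  \<comment> \<open>The covering intervals overlap; disjoint pieces ensure that every energy is
    counted once.\<close>
  define S where "S = disjointed (\<lambda>n. {P n..Q n})"
  have dis: "disjoint_family S" unfolding S_def by (rule disjoint_family_disjointed)
  have US: "(\<Union>n. S n) = D" unfolding S_def UN_disjointed_eq UN ..
  have sub: "S n \<subseteq> {P n..Q n}" for n unfolding S_def by (rule disjointed_subset)
  have S[measurable]: "S n \<in> sets borel" for n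
  proof -
    have "range (\<lambda>n. {P n..Q n}) \<subseteq> sets borel" by (rule image_subsetI) simp
    from sets.range_disjointed_sets[OF this] show ?thesis unfolding S_def by blast
  qed
  have ind: "(\<Sum>n. indicator (S n) l :: ennreal) = indicator D l" for l
    using suminf_indicator[OF dis, of l] unfolding US .
  let ?c = "\<lambda>l. g l / ennreal (F' l)"
  have piece: "(\<lambda>a. \<Sum>l | l \<in> S n \<and> F l = a. ?c l) \<in> borel_measurable borel"
     "(\<integral>\<^sup>+l. indicator (S n) l * g l \<partial>lborel) = (\<integral>\<^sup>+a. (\<Sum>l | l \<in> S n \<and> F l = a. ?c l) \<partial>lborel)" for n
    using PQ[of n] sub[of n] der pos continuous_on_subset[OF cont PQ(2)[of n]]
    by (intro nn_integral_increasing_piece[of "P n" "Q n" F F' "S n" g]; auto)+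
  have split: "(\<Sum>n. \<Sum>l | l \<in> S n \<and> F l = a. ?c l) = (\<Sum>l | l \<in> D \<and> F l = a. ?c l)" for a
  proof -
    let ?X = "{l. l \<in> D \<and> F l = a}"
    have X: "finite ?X" using fin[of a] by simp
    have "(\<Sum>l | l \<in> S n \<and> F l = a. ?c l) = (\<Sum>l\<in>?X. indicator (S n) l * ?c l)" for n
    proof -
      have "S n \<subseteq> D" using sub[of n] PQ(2)[of n] by blast
      then have "{l. l \<in> S n \<and> F l = a} = ?X \<inter> S n" by blast
      then show ?thesis using X by (simp add: sum.inter_restrict indicator_def if_distrib cong: if_cong sum.cong)
    qed
    then have "(\<Sum>n. \<Sum>l | l \<in> S n \<and> F l = a. ?c l) = (\<Sum>n. \<Sum>l\<in>?X. indicator (S n) l * ?c l)" by simp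
    also have "\<dots> = (\<Sum>l\<in>?X. \<Sum>n. indicator (S n) l * ?c l)" by (rule suminf_sum) simp
    also have "\<dots> = (\<Sum>l\<in>?X. ?c l)" by (intro sum.cong) (auto simp: ind)
    finally show ?thesis .
  qed
  have "(\<integral>\<^sup>+l. indicator D l * g l \<partial>lborel) = (\<integral>\<^sup>+l. (\<Sum>n. indicator (S n) l * g l) \<partial>lborel)"
    by (simp add: ind)
  also have "\<dots> = (\<Sum>n. \<integral>\<^sup>+l. indicator (S n) l * g l \<partial>lborel)"
    by (rule nn_integral_suminf) measurable
  also have "\<dots> = (\<Sum>n. \<integral>\<^sup>+a. (\<Sum>l | l \<in> S n \<and> F l = a. ?c l) \<partial>lborel)"
    unfolding piece(2) ..
  also have "\<dots> = (\<integral>\<^sup>+a. (\<Sum>n. \<Sum>l | l \<in> S n \<and> F l = a. ?c l) \<partial>lborel)"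
    using piece(1) by (intro nn_integral_suminf[symmetric]) simp
  also have "\<dots> = (\<integral>\<^sup>+a. (\<Sum>l | l \<in> D \<and> F l = a. ?c l) \<partial>lborel)"
    unfolding split ..
  finally show ?thesis .
qed simp

section \<open>Columns of the resolvent\<close>

text \<open>The solution \<open>s\<close> of \<open>A *v s = axis x 1\<close> by Cramer's rule, an explicit Borel function of \<open>A\<close>;
  for singular \<open>A\<close> the division by \<open>0\<close> makes it \<open>0\<close>.\<close>

definition cramer_col :: "real^'n^'n \<Rightarrow> 'n \<Rightarrow> real^'n" where
  "cramer_col A x = (\<chi> k. det (\<chi> i j. if j = k then axis x 1 $ i else A $ i $ j) / det A)"

lemma cramer_col_iff: "det A \<noteq> 0 \<Longrightarrow> A *v s = axis x 1 \<longleftrightarrow> s = cramer_col A x"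
  unfolding cramer_col_def by (rule cramer)

lemma cramer_col_singular: "det A = 0 \<Longrightarrow> cramer_col A x = 0"
  by (simp add: cramer_col_def vec_eq_iff)

text \<open>\<open>matrix_inv\<close> is a choice whose dependence on the matrix is not visible;
  quotients of determinants make continuity and measurability explicit.\<close>

lemma matrix_inv_axis:
  fixes A :: "real^'n^'n"
  assumes "invertible A"
  shows "matrix_inv A *v axis x 1 = cramer_col A x"
proof -
  have "A ** matrix_inv A = mat 1"
    using assms someI_ex[of "\<lambda>A'. A ** A' = mat 1 \<and> A' ** A = mat 1"]
    unfolding invertible_def matrix_inv_def by blast
  then have "A *v (matrix_inv A *v axis x 1) = axis x 1"
    by (simp add: matrix_vector_mul_assoc)
  then show ?thesis using assms by (simp add: cramer_col_iff invertible_det_nz)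
qed

section \<open>Regularity of Cramer columns in the potential and the energy\<close>

lemma continuous_on_det:
  fixes f :: "'a::topological_space \<Rightarrow> real^'n^'n"
  assumes "continuous_on S f"
  shows "continuous_on S (\<lambda>z. det (f z))"
  unfolding det_def by (intro continuous_intros assms)

lemma continuous_on_replace_column:
  fixes f :: "'a::topological_space \<Rightarrow> real^'n^'n"
  assumes "continuous_on S f"
  shows "continuous_on S (\<lambda>z. \<chi> i j. if j = k then b $ i else f z $ i $ j)"
proof (intro continuous_on_vec_lambda)
  fix i j
  show "continuous_on S (\<lambda>z. if j = k then b $ i else f z $ i $ j)"
    by (cases "j = k") (auto intro!: continuous_intros assms)
qed

lemma continuous_on_cramer_col:
  fixes f :: "'a::topological_space \<Rightarrow> real^'n^'n"
  assumes "continuous_on S f" "\<And>z. z \<in> S \<Longrightarrow> det (f z) \<noteq> 0"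
  shows "continuous_on S (\<lambda>z. cramer_col (f z) x)"
  unfolding cramer_col_def
  by (intro continuous_on_vec_lambda continuous_on_divide continuous_on_det
      continuous_on_replace_column assms) (use assms in auto)

lemma borel_measurable_vec_lambda:
  fixes f :: "'a \<Rightarrow> 'n::finite \<Rightarrow> real"
  assumes "\<And>i. (\<lambda>z. f z i) \<in> borel_measurable M"
  shows "(\<lambda>z. \<chi> i. f z i) \<in> borel_measurable M"
proof (subst borel_measurable_euclidean_space, rule ballI)
  fix b :: "real^'n" assume "b \<in> Basis"
  then obtain i where "b = axis i 1" by (auto simp: Basis_vec_def)
  then show "(\<lambda>z. (\<chi> i. f z i) \<bullet> b) \<in> borel_measurable M"
    using assms by (simp add: cart_eq_inner_axis[symmetric])
qed

lemma borel_measurable_det: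
  fixes f :: "'a \<Rightarrow> real^'n^'n"
  assumes "f \<in> borel_measurable M"
  shows "(\<lambda>z. det (f z)) \<in> borel_measurable M"
  by (rule borel_measurable_continuous_on[OF continuous_on_det assms]) simp

lemma borel_measurable_cramer_col:
  fixes f :: "'a \<Rightarrow> real^'n^'n"
  assumes "f \<in> borel_measurable M"
  shows "(\<lambda>z. cramer_col (f z) x) \<in> borel_measurable M"
  unfolding cramer_col_def
  by (intro borel_measurable_vec_lambda borel_measurable_divide borel_measurable_det assms
      borel_measurable_continuous_on[OF continuous_on_replace_column assms] continuous_on_id)

lemma continuous_on_ham_shift:
  fixes T :: "real^'n^'n"
  assumes "continuous_on S f" "continuous_on S g"
  shows "continuous_on S (\<lambda>z. ham T (f z) - mat (g z))"
proof -
  have "(\<lambda>z. ham T (f z) - mat (g z)) =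
      (\<lambda>z. \<chi> i j. T $ i $ j + (if i = j then f z $ i else 0) - (if i = j then g z else 0))"
    by (simp add: ham_def diag_mat_def mat_def vec_eq_iff fun_eq_iff)
  moreover have "continuous_on S (\<lambda>z. T $ i $ j + (if i = j then f z $ i else 0) - (if i = j then g z else 0))" for i j
    by (cases "i = j") (auto intro!: continuous_intros assms)
  ultimately show ?thesis by (simp only: continuous_on_vec_lambda)
qed

lemma borel_measurable_ham_shift:
  fixes T :: "real^'n^'n"
  assumes "f \<in> borel_measurable M" "g \<in> borel_measurable M"
  shows "(\<lambda>z. ham T (f z) - mat (g z)) \<in> borel_measurable M"
proof -
  have "(\<lambda>z. (\<lambda>p. ham T (fst p) - mat (snd p)) (f z, g z)) \<in> borel_measurable M"
    by (rule borel_measurable_continuous_on)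
      (intro continuous_on_ham_shift continuous_intros borel_measurable_Pair assms)+
  then show ?thesis by simp
qed

section \<open>Rank-one perturbations at a site\<close>

lemma ham_shift_mult:
  fixes T :: "real^'n^'n"
  shows "(ham T (v + t *\<^sub>R axis x 1) - mat l) *v u = (ham T v *v u - l *\<^sub>R u) + (t * u $ x) *\<^sub>R axis x 1"
proof -
  have "((ham T (v + t *\<^sub>R axis x 1) - mat l) *v u) $ i
      = ((ham T v *v u - l *\<^sub>R u) + (t * u $ x) *\<^sub>R axis x 1) $ i" for i
    unfolding matrix_vector_mult_diff_rdistrib mat_mult_vec
    by (simp add: ham_mult_nth axis_def algebra_simps)
  then show ?thesis by (intro vec_eq_iff[THEN iffD2] allI)
qed

text \<open>An eigenvector \<open>\<phi>\<close> with \<open>\<phi> x \<noteq> 0\<close> is, up to scaling, a column of the resolvent of any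
  rank one perturbation at \<open>x\<close>. This is the link between \<open>mu1\<close> and \<open>mu2\<close> (\<open>t = - v $ x\<close>), and it
  also exhibits \<open>\<phi>\<close> as a Borel function of \<open>(v, l)\<close> (\<open>t = 1\<close>).\<close>

lemma cramer_col_rank_one_perturbation:
  fixes T :: "real^'n^'n"
  assumes sym: "transpose T = T" and nd: "nondegenerate (ham T v)"
    and ev: "ham T v *v \<phi> = l *\<^sub>R \<phi>" and x: "\<phi> $ x \<noteq> 0" and t: "t \<noteq> 0"
  shows "det (ham T (v + t *\<^sub>R axis x 1) - mat l) \<noteq> 0"
    and "cramer_col (ham T (v + t *\<^sub>R axis x 1) - mat l) x = (1 / (t * \<phi> $ x)) *\<^sub>R \<phi>"
proof -
  let ?A = "ham T (v + t *\<^sub>R axis x 1) - mat l"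
  have "u = 0" if u: "?A *v u = 0" for u
  proof -
    \<comment> \<open>Pairing this equation with \<phi> kills the left side by symmetry and leaves
      \<open>u $ x = 0\<close>. Then \<open>u\<close> belongs to the simple eigenvalue
      \<open>l\<close>, is a multiple of \<phi>, and vanishes because \<phi> does not vanish at
      \<open>x\<close>.\<close>
    have eq: "ham T v *v u - l *\<^sub>R u = - ((t * u $ x) *\<^sub>R axis x 1)"
      using u unfolding ham_shift_mult by (simp only: eq_neg_iff_add_eq_0)
    have "(ham T v *v \<phi>) \<bullet> u = \<phi> \<bullet> (ham T v *v u)"
      by (rule symmetric_inner[OF transpose_ham[OF sym]])
    then have "\<phi> \<bullet> (ham T v *v u - l *\<^sub>R u) = 0"
      unfolding ev inner_diff_right inner_scaleR_left inner_scaleR_right by simp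
    then have "t * u $ x * \<phi> $ x = 0"
      unfolding eq inner_minus_right inner_scaleR_right cart_eq_inner_axis[symmetric] by simp
    then have ux: "u $ x = 0" using x t by simp
    then have "ham T v *v u = l *\<^sub>R u" using eq by simp
    moreover have "\<phi> \<noteq> 0" using x by auto
    ultimately obtain c where c: "u = c *\<^sub>R \<phi>"
      using nondegenerate_eigenvector_unique[OF nd _ ev] by blast
    then show ?thesis using ux x by simp
  qed
  then have "invertible ?A" unfolding invertible_left_inverse matrix_left_invertible_ker by blast
  then show det: "det ?A \<noteq> 0" by (simp only: invertible_det_nz not_False_eq_True)
  have "?A *v \<phi> = (t * \<phi> $ x) *\<^sub>R axis x 1" unfolding ham_shift_mult ev by simp
  then have "?A *v ((1 / (t * \<phi> $ x)) *\<^sub>R \<phi>) = axis x 1"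
    using x t unfolding matrix_vector_mult_scaleR by simp
  then show "cramer_col ?A x = (1 / (t * \<phi> $ x)) *\<^sub>R \<phi>"
    using cramer_col_iff[OF det] by simp
qed

text \<open>An eigenvector vanishing at \<open>x\<close> does not feel the coupling at
  \<open>x\<close>, so it stays in the kernel. The Cramer column then takes its default 0, which
  agrees with the zero weight of such an eigenvector.\<close>

lemma det_ham_shift_eigenvector_zero:
  fixes T :: "real^'n^'n"
  assumes ev: "ham T v *v \<phi> = l *\<^sub>R \<phi>" and "\<phi> \<noteq> 0" "\<phi> $ x = 0"
  shows "det (ham T (v + t *\<^sub>R axis x 1) - mat l) = 0"
proof (rule ccontr)
  let ?A = "ham T (v + t *\<^sub>R axis x 1) - mat l"
  assume "det ?A \<noteq> 0"
  then have "invertible ?A" by (simp only: invertible_det_nz not_False_eq_True)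
  then have "\<forall>u. ?A *v u = 0 \<longrightarrow> u = 0" by (simp only: invertible_left_inverse matrix_left_invertible_ker)
  moreover have "?A *v \<phi> = 0" unfolding ham_shift_mult ev using assms(3) by simp
  ultimately show False using assms(2) by blast
qed

text \<open>This is \<open>s(l)\<close> of the overview; its entry at \<open>x\<close> is the
  diagonal Green's function at coupling 0.\<close>

abbreviation rcol :: "real^'n^'n \<Rightarrow> 'n \<Rightarrow> ('n \<Rightarrow> real) \<Rightarrow> real \<Rightarrow> real^'n" where
  "rcol T x w l \<equiv> cramer_col (ham T (set_at x 0 w) - mat l) x"

lemma set_at_shift: "set_at x a w = set_at x 0 w + a *\<^sub>R axis x 1"
  by (auto simp: set_at_def axis_def vec_eq_iff)

lemma rcol_solves:
  assumes "det (ham T (set_at x 0 w) - mat l) \<noteq> 0"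
  shows "ham T (set_at x 0 w) *v rcol T x w l = l *\<^sub>R rcol T x w l + axis x 1"
proof -
  have "(ham T (set_at x 0 w) - mat l) *v rcol T x w l = axis x 1"
    using cramer_col_iff[OF assms] by blast
  then show ?thesis unfolding matrix_vector_mult_diff_rdistrib mat_mult_vec by (simp add: algebra_simps)
qed

text \<open>Switching on a coupling \<open>a\<close> adds \<open>a * s $ x\<close> times the basis
  vector at \<open>x\<close> to the right side of the resolvent equation; the chosen value is the
  one that cancels it.\<close>

lemma rcol_eigenvector:
  assumes "det (ham T (set_at x 0 w) - mat l) \<noteq> 0" "rcol T x w l $ x \<noteq> 0"
  shows "ham T (set_at x (- 1 / rcol T x w l $ x) w) *v rcol T x w l = l *\<^sub>R rcol T x w l"
proof -
  let ?s = "rcol T x w l" and ?a = "- 1 / rcol T x w l $ x"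
  have "(ham T (set_at x ?a w) - mat l) *v ?s = axis x 1 + (?a * ?s $ x) *\<^sub>R axis x 1"
    unfolding set_at_shift[of x ?a] ham_shift_mult rcol_solves[OF assms(1)] by simp
  then have "(ham T (set_at x ?a w) - mat l) *v ?s = 0" using assms(2) by simp
  then show ?thesis unfolding matrix_vector_mult_diff_rdistrib mat_mult_vec by simp
qed

lemma good_pairs_iff:
  "(l, w) \<in> good_pairs T x \<longleftrightarrow>
    l \<in> {0..1} \<and> det (ham T (set_at x 0 w) - mat l) \<noteq> 0 \<and> rcol T x w l $ x \<noteq> 0"
proof -
  have "resolvent T l x w $ x $ x = rcol T x w l $ x" if "invertible (ham T (set_at x 0 w) - mat l)"
  proof -
    have "resolvent T l x w $ x $ x = (resolvent T l x w *v axis x 1) $ x"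
      by (simp add: matrix_vector_mult_basis column_def)
    then show ?thesis unfolding resolvent_def matrix_inv_axis[OF that] .
  qed
  then show ?thesis unfolding good_pairs_def invertible_det_nz by force
qed

lemma reconstruct_good:
  assumes "(l, w) \<in> good_pairs T x"
  shows "reconstruct T x (l, w) = (set_at x (- 1 / rcol T x w l $ x) w, l,
    (1 / norm (rcol T x w l)) *\<^sub>R rcol T x w l, x)"
proof -
  have inv: "invertible (ham T (set_at x 0 w) - mat l)"
    using assms by (simp add: good_pairs_iff invertible_det_nz)
  have 1: "resolvent T l x w *v axis x 1 = rcol T x w l"
    unfolding resolvent_def by (rule matrix_inv_axis[OF inv])
  have "resolvent T l x w $ x $ x = (resolvent T l x w *v axis x 1) $ x"
    by (simp add: matrix_vector_mult_basis column_def)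
  then show ?thesis by (simp add: reconstruct_def Let_def 1)
qed

text \<open>The diagonal entry at \<open>x\<close> of G(l) - G(m) = (l - m) G(l) G(m), obtained by
  moving the symmetric matrix across the inner product of the two columns.\<close>

lemma rcol_resolvent_identity:
  assumes sym: "transpose T = T"
    and "det (ham T (set_at x 0 w) - mat l) \<noteq> 0" "det (ham T (set_at x 0 w) - mat m) \<noteq> 0"
  shows "rcol T x w l $ x - rcol T x w m $ x = (l - m) * (rcol T x w l \<bullet> rcol T x w m)"
proof -
  let ?H = "ham T (set_at x 0 w)" and ?s = "rcol T x w"
  have "(?H *v ?s l) \<bullet> ?s m = ?s l \<bullet> (?H *v ?s m)"
    by (rule symmetric_inner[OF transpose_ham[OF sym]])
  then show ?thesis
    unfolding rcol_solves[OF assms(2)] rcol_solves[OF assms(3)] inner_add_left inner_add_right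
      inner_scaleR_left inner_scaleR_right inner_commute[of "axis x 1"] cart_eq_inner_axis[symmetric]
    by (simp only: algebra_simps)
qed

lemma continuous_on_rcol:
  assumes "\<And>l. l \<in> S \<Longrightarrow> det (ham T (set_at x 0 w) - mat l) \<noteq> 0"
  shows "continuous_on S (rcol T x w)"
  by (intro continuous_on_cramer_col continuous_on_ham_shift continuous_intros assms)

lemma open_det_ham_shift: "open {l. det (ham T v - mat l) \<noteq> 0}"
  by (intro open_Collect_neq continuous_on_det continuous_on_ham_shift continuous_intros)

lemma open_rcol_domain:
  "open {l. det (ham T (set_at x 0 w) - mat l) \<noteq> 0 \<and> rcol T x w l $ x \<noteq> 0}"
proof -
  let ?U = "{l. det (ham T (set_at x 0 w) - mat l) \<noteq> 0}"
  have "continuous_on ?U (\<lambda>l. rcol T x w l $ x)"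
    by (intro continuous_intros continuous_on_rcol) simp
  then have "open (?U \<inter> (\<lambda>l. rcol T x w l $ x) -` (- {0}))"
    by (rule continuous_open_preimage) (auto intro: open_det_ham_shift)
  also have "?U \<inter> (\<lambda>l. rcol T x w l $ x) -` (- {0}) =
      {l. det (ham T (set_at x 0 w) - mat l) \<noteq> 0 \<and> rcol T x w l $ x \<noteq> 0}"
    by blast
  finally show ?thesis .
qed

text \<open>By the resolvent identity the difference quotient equals
  \<open>?s l \<bullet> ?s m\<close> near \<open>m\<close>, so continuity of the column is enough to
  pass to the limit.\<close>

lemma rcol_has_derivative:
  assumes sym: "transpose T = T" and m: "det (ham T (set_at x 0 w) - mat m) \<noteq> 0"
  shows "((\<lambda>l. rcol T x w l $ x) has_real_derivative (norm (rcol T x w m))\<^sup>2) (at m)"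
proof -
  let ?s = "rcol T x w" and ?U = "{l. det (ham T (set_at x 0 w) - mat l) \<noteq> 0}"
  have "continuous_on ?U ?s" by (rule continuous_on_rcol) simp
  then have "isCont ?s m"
    using continuous_on_eq_continuous_at[OF open_det_ham_shift] m by blast
  then have "((\<lambda>l. ?s l \<bullet> ?s m) \<longlongrightarrow> ?s m \<bullet> ?s m) (at m)"
    by (intro tendsto_inner tendsto_const) (simp add: isCont_def)
  moreover have "\<forall>\<^sub>F l in at m. (?s l $ x - ?s m $ x) / (l - m) = ?s l \<bullet> ?s m"
  proof -
    have "\<forall>\<^sub>F l in at m. l \<in> ?U \<and> l \<noteq> m"
      using eventually_at_in_open[OF open_det_ham_shift, of m] m by (simp add: eventually_conj_iff)
    then show ?thesis
    proof eventually_elim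
      case (elim l)
      then show ?case using rcol_resolvent_identity[OF sym _ m, of l] by simp
    qed
  qed
  ultimately have "((\<lambda>l. (?s l $ x - ?s m $ x) / (l - m)) \<longlongrightarrow> ?s m \<bullet> ?s m) (at m)"
    by (rule Lim_transform_eventually[OF _ eventually_mono]) simp
  then show ?thesis by (simp add: has_field_derivative_iff dot_square_norm)
qed

text \<open>Hence for every fixed \<open>w\<close> almost every energy is admissible, which is why
  the restriction to \<open>good_pairs\<close> in \<open>mu2\<close> loses no mass.\<close>

lemma finite_bad_energies:
  fixes T :: "real^'n^'n"
  assumes sym: "transpose T = T"
  shows "finite {l. \<not> (det (ham T (set_at x 0 w) - mat l) \<noteq> 0 \<and> rcol T x w l $ x \<noteq> 0)}"
proof -
  let ?H = "ham T (set_at x 0 w)"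
  \<comment> \<open>If column \<open>x\<close> of the resolvent vanishes at \<open>x\<close>, it is an eigenvector of \<open>H\<close> compressed
    to the other sites, so \<open>l\<close> lies in one of two finite spectra.\<close>
  define K where "K = (\<chi> i j. if i = x \<or> j = x then 0 else ?H $ i $ j)"
  have symH: "transpose ?H = ?H" by (rule transpose_ham[OF sym])
  have swap: "?H $ i $ j = ?H $ j $ i" for i j
  proof -
    have "transpose ?H $ i $ j = ?H $ j $ i" by (simp only: transpose_def vec_lambda_beta)
    then show ?thesis unfolding symH .
  qed
  have "transpose K $ i $ j = K $ i $ j" for i j
    using swap[of i j] unfolding K_def transpose_def vec_lambda_beta by auto
  then have "transpose K = K" unfolding vec_eq_iff by blast
  then have "finite (spec ?H \<union> spec K)" using finite_spec symH by blast
  moreover have "l \<in> spec ?H \<union> spec K"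
    if l: "\<not> (det (?H - mat l) \<noteq> 0 \<and> rcol T x w l $ x \<noteq> 0)" for l
  proof (cases "det (?H - mat l) = 0")
    case True
    then have "\<not> invertible (?H - mat l)" by (simp add: invertible_det_nz)
    then obtain u where "u \<noteq> 0" "(?H - mat l) *v u = 0"
      unfolding invertible_left_inverse matrix_left_invertible_ker by blast
    then have "?H *v u = l *\<^sub>R u" unfolding matrix_vector_mult_diff_rdistrib mat_mult_vec by simp
    then show ?thesis using specI[OF \<open>u \<noteq> 0\<close>] by blast
  next
    case False
    let ?s = "rcol T x w l"
    have s0: "?s $ x = 0" using l False by blast
    have eq: "?H *v ?s = l *\<^sub>R ?s + axis x 1" by (rule rcol_solves[OF False])
    have ne: "?s \<noteq> 0"
    proof
      assume "?s = 0"
      then have "axis x 1 = (0 :: real^'n)" using eq by simp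
      then show False by (simp add: axis_eq_0_iff)
    qed
    \<comment> \<open>At \<open>x\<close> both sides are 0. At any other site the deleted column
      would be multiplied by \<open>?s $ x = 0\<close>, and the basis vector at \<open>x\<close>
      contributes nothing.\<close>
    have "(K *v ?s) $ i = (l *\<^sub>R ?s) $ i" for i
    proof (cases "i = x")
      case True
      then show ?thesis using s0 by (simp add: K_def matrix_vector_mult_def)
    next
      case False
      have "(K *v ?s) $ i = (\<Sum>j\<in>UNIV. K $ i $ j * ?s $ j)" by (simp add: matrix_vector_mult_def)
      also have "\<dots> = (\<Sum>j\<in>UNIV. ?H $ i $ j * ?s $ j)"
        using False s0 by (intro sum.cong) (auto simp: K_def)
      also have "\<dots> = (?H *v ?s) $ i" by (simp add: matrix_vector_mult_def)
      also have "\<dots> = (l *\<^sub>R ?s) $ i" unfolding eq using False by (simp add: axis_def)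
      finally show ?thesis .
    qed
    then have "K *v ?s = l *\<^sub>R ?s" by (intro vec_eq_iff[THEN iffD2] allI)
    then show ?thesis using specI[OF ne] by blast
  qed
  ultimately show ?thesis by (blast intro: finite_subset)
qed

section \<open>The \<open>\<sigma>\<close>-algebra \<open>Omega\<close> and the two kernels\<close>

abbreviation quad_borel :: "'n::finite quad measure" where
  "quad_borel \<equiv> borel \<Otimes>\<^sub>M borel \<Otimes>\<^sub>M borel \<Otimes>\<^sub>M count_space UNIV"

lemma measurable_OmegaI:
  assumes "f \<in> N \<rightarrow>\<^sub>M quad_borel" "\<And>z. z \<in> space N \<Longrightarrow> f z \<in> Omega_set"
  shows "f \<in> N \<rightarrow>\<^sub>M Omega"
proof (rule measurableI)
  show "f z \<in> space Omega" if "z \<in> space N" for z using assms(2)[OF that] by (simp only: space_Omega)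
  show "f -` A \<inter> space N \<in> sets N" if "A \<in> sets Omega" for A
  proof -
    have "A \<in> sets quad_borel" using that by (simp add: sets_Omega Omega_sets_def)
    then show ?thesis by (rule measurable_sets[OF assms(1)])
  qed
qed

lemma Omega_set_sets: "Omega_set \<in> sets (quad_borel :: 'n::finite quad measure)"
  unfolding Omega_set_def by (intro pair_measureI) auto

lemma borel_measurable_Omega:
  assumes "f \<in> borel_measurable quad_borel" and flip: "\<And>q. f (flip q) = f q"
  shows "f \<in> borel_measurable Omega"
proof (rule measurableI)
  fix B :: "'b set" assume B: "B \<in> sets borel"
  have "f -` B \<in> sets quad_borel"
    using measurable_sets[OF assms(1) B] by (simp add: space_pair_measure)
  moreover have "flip ` (f -` B \<inter> Omega_set) = f -` B \<inter> Omega_set"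
  proof (intro equalityI subsetI)
    fix q assume "q \<in> flip ` (f -` B \<inter> Omega_set)"
    then show "q \<in> f -` B \<inter> Omega_set" by (auto simp only: flip_in_Omega_set flip vimage_eq Int_iff)
  next
    fix q assume "q \<in> f -` B \<inter> Omega_set"
    then have "flip q \<in> f -` B \<inter> Omega_set" by (auto simp only: flip_in_Omega_set flip vimage_eq Int_iff)
    then show "q \<in> flip ` (f -` B \<inter> Omega_set)" by (metis flip_flip imageI)
  qed
  ultimately show "f -` B \<inter> space Omega \<in> sets Omega"
    unfolding space_Omega sets_Omega Omega_sets_def using Omega_set_sets by auto
qed simp

text \<open>This makes the sign picked by \<open>unit_eigvec\<close> immaterial, as well as the sign
  produced by normalizing a resolvent column.\<close>

lemma Omega_sets_minus:
  assumes "A \<in> Omega_sets" "\<psi> = \<phi> \<or> \<psi> = - \<phi>"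
  shows "(v, l, \<psi>, x) \<in> A \<longleftrightarrow> (v, l, \<phi>, x) \<in> A"
proof -
  have "flip q \<in> A" if "q \<in> A" for q using assms(1) that by (auto simp: Omega_sets_def)
  from this[of "(v, l, \<phi>, x)"] this[of "(v, l, - \<phi>, x)"] show ?thesis
    using assms(2) by (auto simp: flip_def)
qed

lemma normalize_scaled_unit:
  fixes \<phi> :: "real^'n"
  assumes "norm \<phi> = 1" "c \<noteq> 0" "s = c *\<^sub>R \<phi>"
  shows "(1 / norm s) *\<^sub>R s = \<phi> \<or> (1 / norm s) *\<^sub>R s = - \<phi>"
    and "(s $ x)\<^sup>2 / (norm s)\<^sup>2 = (\<phi> $ x)\<^sup>2"
proof -
  have "norm s = \<bar>c\<bar>" using assms by simp
  then show "(1 / norm s) *\<^sub>R s = \<phi> \<or> (1 / norm s) *\<^sub>R s = - \<phi>" "(s $ x)\<^sup>2 / (norm s)\<^sup>2 = (\<phi> $ x)\<^sup>2"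
    using assms by (auto simp: abs_if power_mult_distrib)
qed

text \<open>The joint contribution of eigenvalue \<open>l\<close> and site \<open>x\<close> to the
  probability of \<open>A\<close> given \<open>v\<close>, without the factor
  \<open>1 / CARD('n)\<close>.\<close>

definition spectral_weight :: "real^'n^'n \<Rightarrow> 'n::finite quad set \<Rightarrow> 'n \<Rightarrow> real^'n \<Rightarrow> real \<Rightarrow> ennreal" where
  "spectral_weight T A x v l =
    ennreal ((unit_eigvec (ham T v) l $ x)\<^sup>2) * indicator A (v, l, unit_eigvec (ham T v) l, x)"

text \<open>The summand as written contains the arbitrary \<open>unit_eigvec\<close>; on the
  spectrum of a good potential it coincides with the Borel function \<open>g\<close> built from a
  Cramer column, to which the lemma on finite sections applies.\<close>

lemma measurable_spectral_weight_sum: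
  fixes T :: "real^'n^'n"
  assumes sym: "transpose T = T" and A: "A \<in> Omega_sets"
  shows "(\<lambda>v. \<Sum>l\<in>spec (ham T v). spectral_weight T A x v l) \<in> borel_measurable (restrict_space borel (good_potentials T))"
    (is "?f \<in> borel_measurable ?M")
proof -
  \<comment> \<open>Any fixed nonzero shift would do. The shift by \<open>- v $ x\<close> used for
    \<open>mu2\<close> would be 0 at some potentials.\<close>
  define s where "s p = cramer_col (ham T (fst p + 1 *\<^sub>R axis x 1) - mat (snd p)) x" for p :: "(real^'n) \<times> real"
  define g where "g p = ennreal ((s p $ x)\<^sup>2 / (norm (s p))\<^sup>2) *
      indicator A (fst p, snd p, (1 / norm (s p)) *\<^sub>R s p, x)" for p
  have fst: "fst \<in> borel_measurable (?M \<Otimes>\<^sub>M borel)"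
    by (rule measurable_compose[OF measurable_fst measurable_restrict_space1]) simp
  have s[measurable]: "s \<in> borel_measurable (?M \<Otimes>\<^sub>M borel)"
    unfolding s_def
    by (intro borel_measurable_cramer_col borel_measurable_ham_shift borel_measurable_add fst) auto
  have sx[measurable]: "(\<lambda>p. s p $ x) \<in> borel_measurable (?M \<Otimes>\<^sub>M borel)"
    by (rule borel_measurable_continuous_on[OF _ s]) (intro continuous_intros)
  have [measurable]: "A \<in> sets quad_borel" using A by (simp add: Omega_sets_def)
  have quad: "(\<lambda>p. (fst p, snd p, (1 / norm (s p)) *\<^sub>R s p, x)) \<in> ?M \<Otimes>\<^sub>M borel \<rightarrow>\<^sub>M quad_borel"
    using fst by measurable
  have ind: "(\<lambda>p. indicator A (fst p, snd p, (1 / norm (s p)) *\<^sub>R s p, x) :: ennreal) \<in> borel_measurable (?M \<Otimes>\<^sub>M borel)"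
    by (rule measurable_compose[OF quad]) simp
  have g: "g \<in> borel_measurable (?M \<Otimes>\<^sub>M borel)"
    unfolding g_def by (intro borel_measurable_times_ennreal ind) measurable
  have "(\<lambda>v. \<Sum>l\<in>spec (ham T v). g (v, l)) \<in> borel_measurable ?M"
  proof (rule borel_measurable_sum_finite_sections[OF _ _ _ g])
    fix v assume "v \<in> space ?M"
    then have "nondegenerate (ham T v)" by (auto simp: space_restrict_space good_potentials_def)
    then show "finite (spec (ham T v))" "card (spec (ham T v)) \<le> CARD('n)"
      using finite_spec[OF transpose_ham[OF sym]] card_spec_nondegenerate[OF transpose_ham[OF sym]] by auto
  next
    fix r a :: real
    have "{v \<in> space ?M. spec (ham T v) \<inter> {r..a} \<noteq> {}} = good_potentials T \<inter> {v. spec (ham T v) \<inter> {r..a} \<noteq> {}}"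
      by (auto simp: space_restrict_space)
    also have "\<dots> \<in> sets ?M"
      using closed_spec_meets[of T r a] by (auto simp: sets_restrict_space)
    finally show "{v \<in> space ?M. spec (ham T v) \<inter> {r..a} \<noteq> {}} \<in> sets ?M" .
  qed
  also have "?this \<longleftrightarrow> ?f \<in> borel_measurable ?M"
  proof (intro measurable_cong sum.cong refl)
    fix v l assume v: "v \<in> space ?M" and l: "l \<in> spec (ham T v)"
    let ?\<phi> = "unit_eigvec (ham T v) l"
    have nd: "nondegenerate (ham T v)" using v by (auto simp: space_restrict_space good_potentials_def)
    note ev = unit_eigvec[OF l]
    show "g (v, l) = spectral_weight T A x v l"
    proof (cases "?\<phi> $ x = 0")
      case True
      have "?\<phi> \<noteq> 0" using ev(1) by auto
      then have "s (v, l) = 0"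
        using det_ham_shift_eigenvector_zero[OF ev(2) _ True, of 1] by (simp add: s_def cramer_col_singular)
      then show ?thesis using True by (simp add: g_def spectral_weight_def)
    next
      case False
      have sc: "s (v, l) = (1 / (1 * ?\<phi> $ x)) *\<^sub>R ?\<phi>"
        unfolding s_def using cramer_col_rank_one_perturbation(2)[OF sym nd ev(2) False, of 1] by simp
      have nz: "1 / (1 * ?\<phi> $ x) \<noteq> 0" using False by simp
      show ?thesis
        using Omega_sets_minus[OF A normalize_scaled_unit(1)[OF ev(1) nz sc], of v l x]
          normalize_scaled_unit(2)[OF ev(1) nz sc, of x]
        unfolding g_def spectral_weight_def fst_conv snd_conv indicator_def by simp
    qed
  qed
  finally show ?thesis .
qed

definition eigenpair_kernel :: "real^'n^'n \<Rightarrow> real^'n \<Rightarrow> 'n::finite quad measure" where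
  "eigenpair_kernel T v = uniform_count_measure (spec (ham T v)) \<bind> (\<lambda>l.
     let \<phi> = unit_eigvec (ham T v) l in
     distr (point_measure UNIV (\<lambda>x. ennreal ((\<phi> $ x)\<^sup>2))) Omega (\<lambda>x. (v, l, \<phi>, x)))"

lemma site_kernel:
  fixes T :: "real^'n^'n"
  assumes v: "v \<in> good_potentials T" and l: "l \<in> spec (ham T v)"
  defines "\<phi> \<equiv> unit_eigvec (ham T v) l"
  defines "K \<equiv> distr (point_measure UNIV (\<lambda>x. ennreal ((\<phi> $ x)\<^sup>2))) Omega (\<lambda>x. (v, l, \<phi>, x))"
  shows "prob_space K" "sets K = sets Omega"
    "A \<in> Omega_sets \<Longrightarrow> emeasure K A = (\<Sum>x\<in>UNIV. spectral_weight T A x v l)"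
proof -
  let ?P = "point_measure UNIV (\<lambda>x. ennreal ((\<phi> $ x)\<^sup>2))"
  have n: "norm \<phi> = 1" unfolding \<phi>_def by (rule unit_eigvec[OF l])
  have "l \<in> {0..1}" using v l by (auto simp: good_potentials_def)
  then have "(v, l, \<phi>, x) \<in> Omega_set" for x using n by (simp add: Omega_set_def)
  then have m: "(\<lambda>x. (v, l, \<phi>, x)) \<in> ?P \<rightarrow>\<^sub>M Omega"
    unfolding measurable_def by (auto simp: space_Omega space_point_measure sets_point_measure)
  have e: "emeasure ?P X = (\<Sum>x\<in>X. ennreal ((\<phi> $ x)\<^sup>2))" for X
    by (rule emeasure_point_measure_finite) auto
  have "(\<Sum>x\<in>UNIV. (\<phi> $ x)\<^sup>2) = 1"
    using n by (simp add: norm_vec_def L2_set_def)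
  then have "prob_space ?P"
    by (intro prob_spaceI) (simp add: e space_point_measure sum_ennreal)
  then show "prob_space K" unfolding K_def using m by (rule prob_space.prob_space_distr)
  show "sets K = sets Omega" by (simp add: K_def)
  assume A: "A \<in> Omega_sets"
  have "emeasure K A = emeasure ?P {x. (v, l, \<phi>, x) \<in> A}"
    unfolding K_def using A by (subst emeasure_distr[OF m]) (auto simp: sets_Omega space_point_measure vimage_def)
  also have "\<dots> = (\<Sum>x\<in>UNIV. ennreal ((\<phi> $ x)\<^sup>2) * indicator {x. (v, l, \<phi>, x) \<in> A} x)"
    unfolding e by (simp add: indicator_def if_distrib sum.If_cases cong: if_cong)
  also have "\<dots> = (\<Sum>x\<in>UNIV. spectral_weight T A x v l)"
    by (simp add: spectral_weight_def \<phi>_def indicator_def)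
  finally show "emeasure K A = (\<Sum>x\<in>UNIV. spectral_weight T A x v l)" .
qed

lemma eigenpair_kernel:
  fixes T :: "real^'n^'n"
  assumes sym: "transpose T = T" and v: "v \<in> good_potentials T"
  shows "prob_space (eigenpair_kernel T v)" "sets (eigenpair_kernel T v) = sets Omega"
    "A \<in> Omega_sets \<Longrightarrow> emeasure (eigenpair_kernel T v) A =
      (\<Sum>x\<in>UNIV. \<Sum>l\<in>spec (ham T v). ennreal (1 / CARD('n)) * spectral_weight T A x v l)"
proof -
  let ?U = "uniform_count_measure (spec (ham T v))"
  let ?K = "\<lambda>l. let \<phi> = unit_eigvec (ham T v) l in
     distr (point_measure UNIV (\<lambda>x. ennreal ((\<phi> $ x)\<^sup>2))) Omega (\<lambda>x. (v, l, \<phi>, x))"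
  have nd: "nondegenerate (ham T v)" using v by (auto simp: good_potentials_def)
  have fin: "finite (spec (ham T v))" by (rule finite_spec[OF transpose_ham[OF sym]])
  have card: "card (spec (ham T v)) = CARD('n)"
    by (rule card_spec_nondegenerate[OF transpose_ham[OF sym] nd])
  then have ne: "spec (ham T v) \<noteq> {}" by auto
  have K: "?K \<in> ?U \<rightarrow>\<^sub>M prob_algebra Omega"
    unfolding measurable_def
    using site_kernel[OF v] by (auto simp: Let_def space_prob_algebra space_uniform_count_measure sets_uniform_count_measure)
  have U: "prob_space ?U"
    using fin ne by (intro prob_spaceI)
      (simp add: space_uniform_count_measure emeasure_uniform_count_measure)
  have U': "?U \<in> space (prob_algebra ?U)" using U by (simp add: space_prob_algebra)
  show "prob_space (eigenpair_kernel T v)" "sets (eigenpair_kernel T v) = sets Omega"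
    unfolding eigenpair_kernel_def by (rule prob_space_bind'[OF U' K], rule sets_bind'[OF U' K])
  assume A: "A \<in> Omega_sets"
  have "emeasure (eigenpair_kernel T v) A = (\<integral>\<^sup>+l. emeasure (?K l) A \<partial>?U)"
    unfolding eigenpair_kernel_def
    using ne A by (intro emeasure_bind[where N = Omega] measurable_prob_algebraD[OF K]) (auto simp: space_uniform_count_measure sets_Omega)
  also have "\<dots> = (\<Sum>l\<in>spec (ham T v). ennreal (1 / CARD('n)) * emeasure (?K l) A)"
    unfolding uniform_count_measure_def by (simp add: nn_integral_point_measure_finite fin card)
  also have "\<dots> = (\<Sum>l\<in>spec (ham T v). \<Sum>x\<in>UNIV. ennreal (1 / CARD('n)) * spectral_weight T A x v l)"
    using site_kernel(3)[OF v _ A] by (intro sum.cong) (auto simp: Let_def sum_distrib_left)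
  \<comment> \<open>The site becomes the outer index because the coupling is averaged at one site at
    a time.\<close>
  also have "\<dots> = (\<Sum>x\<in>UNIV. \<Sum>l\<in>spec (ham T v). ennreal (1 / CARD('n)) * spectral_weight T A x v l)"
    by (rule sum.swap)
  finally show "emeasure (eigenpair_kernel T v) A = \<dots>" .
qed

text \<open>\<open>reconstruct\<close> with Cramer columns in place of \<open>matrix_inv\<close>:
  the two agree on \<open>good_pairs\<close>, but this version is Borel without any
  restriction.\<close>

definition rec_quad :: "real^'n^'n \<Rightarrow> 'n \<Rightarrow> ('n \<Rightarrow> real) \<Rightarrow> real \<Rightarrow> 'n::finite quad" where
  "rec_quad T x w l = (set_at x (- 1 / rcol T x w l $ x) w, l, (1 / norm (rcol T x w l)) *\<^sub>R rcol T x w l, x)"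

lemma borel_measurable_set_at:
  assumes "a \<in> borel_measurable M" "\<And>y. y \<noteq> x \<Longrightarrow> (\<lambda>z. w z y) \<in> borel_measurable M"
  shows "(\<lambda>z. set_at x (a z) (w z) :: real^'n) \<in> borel_measurable M"
  unfolding set_at_def
proof (rule borel_measurable_vec_lambda)
  fix y show "(\<lambda>z. if y = x then a z else w z y) \<in> borel_measurable M"
    using assms by (cases "y = x") auto
qed

lemma borel_measurable_vec_nth:
  assumes "f \<in> borel_measurable M"
  shows "(\<lambda>z. (f z :: real^'n) $ i) \<in> borel_measurable M"
  by (rule borel_measurable_continuous_on[OF _ assms]) (intro continuous_intros)

context
  fixes T :: "real^'n^'n" and x :: 'n and M :: "'a measure" and w :: "'a \<Rightarrow> 'n \<Rightarrow> real" and l :: "'a \<Rightarrow> real"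
  assumes l[measurable]: "l \<in> borel_measurable M"
    and w: "\<And>y. y \<noteq> x \<Longrightarrow> (\<lambda>z. w z y) \<in> borel_measurable M"
begin

text \<open>The general \<open>M\<close> serves two situations, the energy line with
  \<open>w\<close> fixed and the product space of pairs. Only the components of \<open>w\<close> off
  \<open>x\<close> need to be measurable, since \<open>set_at\<close> overwrites the one at
  \<open>x\<close>.\<close>

lemma borel_measurable_resolvent_matrix: "(\<lambda>z. ham T (set_at x 0 (w z)) - mat (l z)) \<in> borel_measurable M"
  by (intro borel_measurable_ham_shift borel_measurable_set_at w l) auto

lemma borel_measurable_rcol: "(\<lambda>z. rcol T x (w z) (l z)) \<in> borel_measurable M"
  by (intro borel_measurable_cramer_col borel_measurable_resolvent_matrix)

lemma measurable_rec_quad: "(\<lambda>z. rec_quad T x (w z) (l z)) \<in> M \<rightarrow>\<^sub>M quad_borel"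
proof -
  have s[measurable]: "(\<lambda>z. rcol T x (w z) (l z)) \<in> borel_measurable M" by (rule borel_measurable_rcol)
  have [measurable]: "(\<lambda>z. rcol T x (w z) (l z) $ x) \<in> borel_measurable M"
    by (rule borel_measurable_vec_nth[OF s])
  have [measurable]: "(\<lambda>z. set_at x (- 1 / rcol T x (w z) (l z) $ x) (w z)) \<in> borel_measurable M"
    by (intro borel_measurable_set_at w) auto
  show ?thesis unfolding rec_quad_def by measurable
qed

lemma sets_resolvent_domain:
  "{z \<in> space M. det (ham T (set_at x 0 (w z)) - mat (l z)) \<noteq> 0 \<and> rcol T x (w z) (l z) $ x \<noteq> 0} \<in> sets M"
proof -
  have [measurable]: "(\<lambda>z. rcol T x (w z) (l z) $ x) \<in> borel_measurable M"
    by (rule borel_measurable_vec_nth[OF borel_measurable_rcol])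
  have [measurable]: "(\<lambda>z. det (ham T (set_at x 0 (w z)) - mat (l z))) \<in> borel_measurable M"
    by (intro borel_measurable_det borel_measurable_resolvent_matrix)
  show ?thesis by measurable
qed

end

section \<open>Spectral averaging and the law \<open>mu1\<close>\<close>

locale random_hamiltonian =
  fixes T :: "real^'n^'n" and \<rho> :: "'n \<Rightarrow> real measure"
  assumes sym: "transpose T = T"
    and prob: "\<And>x. prob_space (\<rho> x)"
    and sets_rho: "\<And>x. sets (\<rho> x) = sets borel"
    and ac: "\<And>x. absolutely_continuous lborel (\<rho> x)"
    and good: "AE v in potential_law \<rho>. v \<in> good_potentials T"
begin

abbreviation dens :: "'n \<Rightarrow> real \<Rightarrow> ennreal" where
  "dens x \<equiv> RN_deriv lborel (\<rho> x)"

abbreviation resolvent_domain :: "'n \<Rightarrow> ('n \<Rightarrow> real) \<Rightarrow> real set" where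
  "resolvent_domain x w \<equiv> {l. det (ham T (set_at x 0 w) - mat l) \<noteq> 0 \<and> rcol T x w l $ x \<noteq> 0}"

section \<open>Disintegration of the potential law along one coupling\<close>

lemma density_rho: "density lborel (dens x) = \<rho> x"
  by (rule sigma_finite_measure.density_RN_deriv[OF sigma_finite_lborel ac]) (simp add: sets_rho)

lemma borel_measurable_dens [measurable]: "dens x \<in> borel_measurable borel"
  using borel_measurable_RN_deriv[of lborel "\<rho> x"] by simp

lemma measurable_rho_iff: "f \<in> \<rho> x \<rightarrow>\<^sub>M N \<longleftrightarrow> f \<in> borel \<rightarrow>\<^sub>M N"
  by (rule arg_cong2[where f = "(\<in>)", OF refl measurable_cong_sets[OF sets_rho refl]])

lemma borel_measurable_component: "i \<in> I \<Longrightarrow> (\<lambda>w. w i) \<in> borel_measurable (Pi\<^sub>M I \<rho>)"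
  using measurable_component_singleton[of i I \<rho>] measurable_cong_sets[OF refl sets_rho] by blast

lemma measurable_vec: "(\<lambda>w. \<chi> x. w x) \<in> borel_measurable (Pi\<^sub>M UNIV \<rho>)"
  by (intro borel_measurable_vec_lambda borel_measurable_component) simp

lemma prob_space_potential: "prob_space (potential_law \<rho>)"
  unfolding potential_law_def by (intro prob_space.prob_space_distr prob_space_PiM prob measurable_vec)

lemma sets_potential: "sets (potential_law \<rho>) = sets borel"
  by (simp add: potential_law_def)

lemma good_sets: "good_potentials T \<in> sets (potential_law \<rho>)"
  using sets_good_potentials by (simp add: sets_potential)

lemma measurable_set_at_pair:
  "(\<lambda>p. set_at x (snd p) (fst p)) \<in> borel_measurable (Pi\<^sub>M (UNIV - {x}) \<rho> \<Otimes>\<^sub>M \<rho> x)"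
proof (rule borel_measurable_set_at)
  show "snd \<in> borel_measurable (Pi\<^sub>M (UNIV - {x}) \<rho> \<Otimes>\<^sub>M \<rho> x)"
    using measurable_snd measurable_cong_sets[OF refl sets_rho] by blast
  show "(\<lambda>z. fst z y) \<in> borel_measurable (Pi\<^sub>M (UNIV - {x}) \<rho> \<Otimes>\<^sub>M \<rho> x)" if "y \<noteq> x" for y
    by (rule measurable_compose[OF measurable_fst borel_measurable_component]) (use that in simp)
qed

lemma measurable_set_at: "(\<lambda>a. set_at x a w) \<in> borel_measurable borel"
  by (rule borel_measurable_set_at) auto

lemma borel_measurable_inner_integral:
  assumes "h \<in> borel_measurable borel"
  shows "(\<lambda>w. \<integral>\<^sup>+a. h (set_at x a w) \<partial>\<rho> x) \<in> borel_measurable (Pi\<^sub>M (UNIV - {x}) \<rho>)"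
proof -
  interpret x: prob_space "\<rho> x" by (rule prob)
  show ?thesis
    by (rule x.borel_measurable_nn_integral)
      (use measurable_compose[OF measurable_set_at_pair assms] in \<open>simp add: case_prod_beta\<close>)
qed

text \<open>Tonelli with the site \<open>x\<close> singled out, so that the inner integral runs over
  the coupling that spectral averaging treats.\<close>

lemma nn_integral_potential:
  assumes h: "h \<in> borel_measurable borel"
  shows "(\<integral>\<^sup>+v. h v \<partial>potential_law \<rho>) = (\<integral>\<^sup>+w. \<integral>\<^sup>+a. h (set_at x a w) \<partial>\<rho> x \<partial>Pi\<^sub>M (UNIV - {x}) \<rho>)"
proof -
  interpret product_sigma_finite \<rho>
    by (intro product_sigma_finite.intro prob_space_imp_sigma_finite prob)
  have I: "insert x (UNIV - {x}) = (UNIV :: 'n set)" by blast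
  have "(\<integral>\<^sup>+v. h v \<partial>potential_law \<rho>) = (\<integral>\<^sup>+w. h (\<chi> y. w y) \<partial>Pi\<^sub>M (insert x (UNIV - {x})) \<rho>)"
    unfolding potential_law_def I using h by (intro nn_integral_distr measurable_vec) simp
  also have "\<dots> = (\<integral>\<^sup>+w. \<integral>\<^sup>+a. h (\<chi> y. (w(x := a)) y) \<partial>\<rho> x \<partial>Pi\<^sub>M (UNIV - {x}) \<rho>)"
    by (rule product_nn_integral_insert) (use measurable_compose[OF measurable_vec h] in \<open>simp_all add: I\<close>)
  also have "\<dots> = (\<integral>\<^sup>+w. \<integral>\<^sup>+a. h (set_at x a w) \<partial>\<rho> x \<partial>Pi\<^sub>M (UNIV - {x}) \<rho>)"
    by (simp add: set_at_def)
  finally show ?thesis .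
qed

text \<open>Tonelli for the indicator of the null event of bad potentials.\<close>

lemma AE_good_fibres:
  "AE w in Pi\<^sub>M (UNIV - {x}) \<rho>. AE a in \<rho> x. set_at x a w \<in> good_potentials T"
proof -
  let ?h = "indicator (- good_potentials T) :: real^'n \<Rightarrow> ennreal"
  have h: "?h \<in> borel_measurable borel" by (intro borel_measurable_indicator borel_comp sets_good_potentials)
  have "(\<integral>\<^sup>+v. ?h v \<partial>potential_law \<rho>) = 0"
    using good by (subst nn_integral_0_iff_AE) (auto simp: measurable_cong_sets[OF sets_potential refl] h indicator_def)
  then have "AE w in Pi\<^sub>M (UNIV - {x}) \<rho>. (\<integral>\<^sup>+a. ?h (set_at x a w) \<partial>\<rho> x) = 0"
    unfolding nn_integral_potential[OF h, of x]
    by (subst (asm) nn_integral_0_iff_AE[OF borel_measurable_inner_integral[OF h]])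
  then show ?thesis
  proof eventually_elim
    case (elim w)
    then have "AE a in \<rho> x. ?h (set_at x a w) = 0"
      by (subst (asm) nn_integral_0_iff_AE)
        (simp_all add: measurable_rho_iff measurable_compose[OF measurable_set_at h])
    then show ?case by (simp add: indicator_eq_0_iff)
  qed
qed

text \<open>The right index set lies in the spectrum, and the eigenvalues it misses have
  eigenvectors vanishing at \<open>x\<close>, so they weigh nothing. On the common part the weight
  is the reciprocal of the derivative of the coupling.\<close>

lemma spectral_sum_eq:
  assumes v: "set_at x a w \<in> good_potentials T" and a: "a \<noteq> 0" and A: "A \<in> Omega_sets"
  shows "(\<Sum>l\<in>spec (ham T (set_at x a w)). spectral_weight T A x (set_at x a w) l) =
    (\<Sum>l | l \<in> resolvent_domain x w \<and> - 1 / rcol T x w l $ x = a.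
       indicator {0..1} l * indicator A (rec_quad T x w l) /
       ennreal ((norm (rcol T x w l))\<^sup>2 / (rcol T x w l $ x)\<^sup>2))"
proof (rule sum.mono_neutral_cong)
  let ?v = "set_at x a w" and ?s = "rcol T x w"
  let ?H = "ham T ?v" and ?X = "{l. l \<in> resolvent_domain x w \<and> - 1 / rcol T x w l $ x = a}"
  have nd: "nondegenerate ?H" and bd: "spec ?H \<subseteq> {0..1}" using v by (auto simp: good_potentials_def)
  have eig: "?H *v ?s l = l *\<^sub>R ?s l" and nz: "?s l $ x \<noteq> 0" if "l \<in> ?X" for l
    using that rcol_eigenvector[of T x w l] by auto
  have sub: "?X \<subseteq> spec ?H"
  proof
    fix l assume l: "l \<in> ?X"
    have "?s l \<noteq> 0" using nz[OF l] by auto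
    then show "l \<in> spec ?H" using eig[OF l] by (rule specI)
  qed
  show fin: "finite (spec ?H)" by (rule finite_spec[OF transpose_ham[OF sym]])
  show "finite ?X" by (rule finite_subset[OF sub fin])
  show "indicator {0..1} l * indicator A (rec_quad T x w l) /
       ennreal ((norm (?s l))\<^sup>2 / (?s l $ x)\<^sup>2) = 0" if "l \<in> ?X - spec ?H" for l
    using that sub by blast
  \<comment> \<open>If the eigenvector did not vanish at \<open>x\<close>, removing the coupling
    (shift by \<open>- a\<close>) would exhibit it as a resolvent column with entry
    \<open>- 1 / a\<close> at \<open>x\<close>, placing \<open>l\<close> in
    \<open>?X\<close>.\<close>
  show "spectral_weight T A x ?v l = 0" if "l \<in> spec ?H - ?X" for l
  proof -
    let ?\<phi> = "unit_eigvec ?H l"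
    have l: "l \<in> spec ?H" "l \<notin> ?X" using that by auto
    note ev = unit_eigvec[OF l(1)]
    have "?\<phi> $ x = 0"
    proof (rule ccontr)
      assume x: "?\<phi> $ x \<noteq> 0"
      have shift: "?v + (- a) *\<^sub>R axis x 1 = set_at x 0 w" by (subst set_at_shift) simp
      have "- a \<noteq> 0" using a by simp
      note C = cramer_col_rank_one_perturbation[OF sym nd ev(2) x this, unfolded shift]
      have "?s l $ x = - 1 / a" unfolding C(2) using x by simp
      then have "l \<in> ?X" using C(1) a by simp
      then show False using l by blast
    qed
    then show ?thesis by (simp add: spectral_weight_def)
  qed
  show "spectral_weight T A x ?v l = indicator {0..1} l * indicator A (rec_quad T x w l) /
       ennreal ((norm (?s l))\<^sup>2 / (?s l $ x)\<^sup>2)" if "l \<in> spec ?H \<inter> ?X" for l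
  proof -
    let ?\<phi> = "unit_eigvec ?H l"
    have l: "l \<in> spec ?H" "l \<in> ?X" using that by auto
    note ev = unit_eigvec[OF l(1)]
    have "?\<phi> \<noteq> 0" using ev(1) by auto
    then obtain c where c: "?s l = c *\<^sub>R ?\<phi>"
      using nondegenerate_eigenvector_unique[OF nd eig[OF l(2)] ev(2)] by blast
    have c0: "c \<noteq> 0" using nz[OF l(2)] unfolding c by auto
    have rec: "rec_quad T x w l = (?v, l, (1 / norm (?s l)) *\<^sub>R ?s l, x)"
      using l(2) unfolding rec_quad_def by simp
    have w: "(?\<phi> $ x)\<^sup>2 = 1 / ((norm (?s l))\<^sup>2 / (?s l $ x)\<^sup>2)"
      using normalize_scaled_unit(2)[OF ev(1) c0 c, of x] by simp
    have pos: "(norm (?s l))\<^sup>2 / (?s l $ x)\<^sup>2 > 0"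
      using nz[OF l(2)] by (intro divide_pos_pos) auto
    have W: "ennreal ((?\<phi> $ x)\<^sup>2) = 1 / ennreal ((norm (?s l))\<^sup>2 / (?s l $ x)\<^sup>2)"
      unfolding w using divide_ennreal[OF _ pos, of 1] by simp
    have "rec_quad T x w l \<in> A \<longleftrightarrow> (?v, l, ?\<phi>, x) \<in> A"
      unfolding rec using A normalize_scaled_unit(1)[OF ev(1) c0 c] by (rule Omega_sets_minus)
    moreover have "l \<in> {0..1}" using bd l by blast
    ultimately show ?thesis unfolding spectral_weight_def W by (simp add: indicator_def)
  qed
qed

text \<open>Every energy in the fibre is an eigenvalue at coupling \<open>a\<close>. This supplies
  the finiteness that the area formula requires.\<close>

lemma finite_coupling_fibre: "finite {l \<in> resolvent_domain x w. - 1 / rcol T x w l $ x = a}"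
proof (rule finite_subset)
  show "{l \<in> resolvent_domain x w. - 1 / rcol T x w l $ x = a} \<subseteq> spec (ham T (set_at x a w))"
  proof
    fix l assume "l \<in> {l \<in> resolvent_domain x w. - 1 / rcol T x w l $ x = a}"
    then have l: "det (ham T (set_at x 0 w) - mat l) \<noteq> 0" "rcol T x w l $ x \<noteq> 0" "- 1 / rcol T x w l $ x = a"
      by auto
    have "rcol T x w l \<noteq> 0" using l(2) by auto
    then show "l \<in> spec (ham T (set_at x a w))" using rcol_eigenvector[OF l(1,2)] unfolding l(3) by (rule specI)
  qed
  show "finite (spec (ham T (set_at x a w)))" by (rule finite_spec[OF transpose_ham[OF sym]])
qed

lemma coupling_has_derivative:
  assumes "l \<in> resolvent_domain x w"
  shows "((\<lambda>l. - 1 / rcol T x w l $ x) has_real_derivative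
    (norm (rcol T x w l))\<^sup>2 / (rcol T x w l $ x)\<^sup>2) (at l)"
proof -
  have "det (ham T (set_at x 0 w) - mat l) \<noteq> 0" and nz: "rcol T x w l $ x \<noteq> 0" using assms by auto
  note d = rcol_has_derivative[OF sym this(1)]
  show ?thesis
    using DERIV_divide[OF DERIV_const[of "- 1"] d nz] by (simp only: power2_eq_square) simp
qed

text \<open>Integrating the coupling \<open>a\<close> at \<open>x\<close> against Lebesgue measure turns the spectral
  measure at \<open>x\<close> into Lebesgue measure in the energy \<open>l\<close>.\<close>

lemma spectral_averaging:
  assumes A: "A \<in> Omega_sets" and ae: "AE a in \<rho> x. set_at x a w \<in> good_potentials T"
  defines "h \<equiv> \<lambda>v. (\<Sum>l\<in>spec (ham T v). spectral_weight T A x v l) * indicator (good_potentials T) v"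
  assumes h: "h \<in> borel_measurable borel"
  shows "(\<integral>\<^sup>+a. h (set_at x a w) \<partial>\<rho> x) = (\<integral>\<^sup>+l. indicator (resolvent_domain x w) l *
    (dens x (- 1 / rcol T x w l $ x) * (indicator {0..1} l * indicator A (rec_quad T x w l))) \<partial>lborel)"
proof -
  let ?s = "rcol T x w" let ?F = "\<lambda>l. - 1 / ?s l $ x" and ?F' = "\<lambda>l. (norm (?s l))\<^sup>2 / (?s l $ x)\<^sup>2"
  define g where "g l = dens x (?F l) * (indicator {0..1} l * indicator A (rec_quad T x w l))" for l
  have [measurable]: "(\<lambda>l. ?s l $ x) \<in> borel_measurable borel"
    by (intro borel_measurable_vec_nth borel_measurable_rcol) auto
  have Aq: "A \<in> sets quad_borel" using A by (simp add: Omega_sets_def)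
  have rec: "(\<lambda>l. rec_quad T x w l) \<in> borel \<rightarrow>\<^sub>M quad_borel"
    by (rule measurable_rec_quad) auto
  have [measurable]: "(\<lambda>l. indicator A (rec_quad T x w l) :: ennreal) \<in> borel_measurable borel"
    by (rule measurable_compose[OF rec borel_measurable_indicator[OF Aq]])
  have g: "g \<in> borel_measurable borel" unfolding g_def by measurable
  have cont: "continuous_on (resolvent_domain x w) ?s" by (rule continuous_on_rcol) simp
  have "(\<integral>\<^sup>+a. h (set_at x a w) \<partial>density lborel (dens x)) = (\<integral>\<^sup>+a. dens x a * h (set_at x a w) \<partial>lborel)"
    by (rule nn_integral_density) (simp_all add: measurable_compose[OF measurable_set_at h])
  then have "(\<integral>\<^sup>+a. h (set_at x a w) \<partial>\<rho> x) = (\<integral>\<^sup>+a. dens x a * h (set_at x a w) \<partial>lborel)"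
    unfolding density_rho .
  also have "\<dots> = (\<integral>\<^sup>+a. (\<Sum>l | l \<in> resolvent_domain x w \<and> ?F l = a. g l / ennreal (?F' l)) \<partial>lborel)"
  proof (rule nn_integral_cong_AE)
    have "AE a in density lborel (dens x). set_at x a w \<in> good_potentials T"
      unfolding density_rho by (rule ae)
    \<comment> \<open>Goodness is known only almost everywhere for \<open>\<rho> x\<close>; at
      couplings where the density vanishes, both integrands are 0 anyway.\<close>
    then have "AE a in lborel. 0 < dens x a \<longrightarrow> set_at x a w \<in> good_potentials T"
      by (subst (asm) AE_density) simp_all
    \<comment> \<open>At coupling 0 the sum over the fibre is empty while the spectral sum need not
      vanish, so this single point has to be discarded.\<close>
    moreover have "AE a in lborel. a \<noteq> (0::real)" by (rule AE_lborel_singleton)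
    ultimately show "AE a in lborel. dens x a * h (set_at x a w) =
        (\<Sum>l | l \<in> resolvent_domain x w \<and> ?F l = a. g l / ennreal (?F' l))"
    proof eventually_elim
      case (elim a)
      have "(\<Sum>l | l \<in> resolvent_domain x w \<and> ?F l = a. g l / ennreal (?F' l)) = dens x a *
        (\<Sum>l | l \<in> resolvent_domain x w \<and> ?F l = a. indicator {0..1} l * indicator A (rec_quad T x w l) / ennreal (?F' l))"
        unfolding sum_distrib_left by (intro sum.cong) (auto simp: g_def ennreal_times_divide)
      moreover have "dens x a * h (set_at x a w) = dens x a *
        (\<Sum>l | l \<in> resolvent_domain x w \<and> ?F l = a. indicator {0..1} l * indicator A (rec_quad T x w l) / ennreal (?F' l))"
      proof (cases "dens x a = 0")
        case False
        then have good: "set_at x a w \<in> good_potentials T" using elim(1) by (simp add: zero_less_iff_neq_zero)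
        show ?thesis unfolding spectral_sum_eq[OF good elim(2) A, symmetric] using good by (simp add: h_def)
      qed simp
      ultimately show ?case by simp
    qed
  qed
  also have "\<dots> = (\<integral>\<^sup>+l. indicator (resolvent_domain x w) l * g l \<partial>lborel)"
  proof (rule nn_integral_area_formula[symmetric])
    show "continuous_on (resolvent_domain x w) ?F'" by (intro continuous_intros cont) auto
    show "0 < ?F' l" if "l \<in> resolvent_domain x w" for l using that by (intro divide_pos_pos) auto
  qed (use open_rcol_domain coupling_has_derivative finite_coupling_fibre g in auto)
  finally show ?thesis by (simp add: g_def)
qed

section \<open>The law \<open>mu1\<close> as an iterated integral\<close>

lemma borel_measurable_good_spectral_sum:
  "A \<in> Omega_sets \<Longrightarrow> (\<lambda>v. (\<Sum>l\<in>spec (ham T v). spectral_weight T A x v l) * indicator (good_potentials T) v)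
    \<in> borel_measurable borel"
  using measurable_spectral_weight_sum[OF sym, of A x] sets_good_potentials[of T]
  by (subst borel_measurable_restrict_space_iff_ennreal[symmetric]) auto

lemma prob_space_restricted: "prob_space (restrict_space (potential_law \<rho>) (good_potentials T))"
  by (intro prob_space_restrict_space good_sets prob_space.emeasure_eq_1_AE[OF prob_space_potential] good)

text \<open>The measurability that lets the outer \<open>bind\<close> in \<open>mu1\<close> be
  computed as an integral over the potential.\<close>

lemma eigenpair_kernel_measurable:
  "eigenpair_kernel T \<in> restrict_space (potential_law \<rho>) (good_potentials T) \<rightarrow>\<^sub>M prob_algebra Omega"
    (is "_ \<in> ?R \<rightarrow>\<^sub>M _")
proof (rule measurable_prob_algebraI)
  have sp: "space ?R = good_potentials T"
    using sets_eq_imp_space_eq[OF sets_potential] by (simp add: space_restrict_space)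
  have cong: "borel_measurable ?R = borel_measurable (restrict_space borel (good_potentials T))"
    by (intro measurable_cong_sets sets_restrict_space_cong sets_potential refl)
  show "prob_space (eigenpair_kernel T v)" if "v \<in> space ?R" for v
    using that eigenpair_kernel(1)[OF sym] by (simp add: sp)
  show "eigenpair_kernel T \<in> ?R \<rightarrow>\<^sub>M subprob_algebra Omega"
  proof (rule measurable_subprob_algebra)
    show "subprob_space (eigenpair_kernel T v)" if "v \<in> space ?R" for v
      using that eigenpair_kernel(1)[OF sym] by (simp add: sp prob_space_imp_subprob_space)
    show "sets (eigenpair_kernel T v) = sets Omega" if "v \<in> space ?R" for v
      using that eigenpair_kernel(2)[OF sym] by (simp add: sp)
    show "(\<lambda>v. emeasure (eigenpair_kernel T v) A) \<in> borel_measurable ?R" if "A \<in> sets Omega" for A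
    proof -
      have A: "A \<in> Omega_sets" using that by (simp add: sets_Omega)
      have "(\<lambda>v. \<Sum>x\<in>UNIV. ennreal (1 / CARD('n)) * (\<Sum>l\<in>spec (ham T v). spectral_weight T A x v l)) \<in> borel_measurable ?R"
        unfolding cong by (intro borel_measurable_sum borel_measurable_times_ennreal borel_measurable_const
            measurable_spectral_weight_sum[OF sym A])
      also have "?this \<longleftrightarrow> ?thesis"
        by (rule measurable_cong) (simp add: sp eigenpair_kernel(3)[OF sym _ A] sum_distrib_left)
      finally show ?thesis .
    qed
  qed
qed

lemma mu1_bind: "mu1 T \<rho> = restrict_space (potential_law \<rho>) (good_potentials T) \<bind> eigenpair_kernel T"
  unfolding mu1_def eigenpair_kernel_def ..

lemma mu1_prob: "prob_space (mu1 T \<rho>)" "sets (mu1 T \<rho>) = sets Omega"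
proof -
  have "restrict_space (potential_law \<rho>) (good_potentials T) \<in>
      space (prob_algebra (restrict_space (potential_law \<rho>) (good_potentials T)))"
    using prob_space_restricted by (simp add: space_prob_algebra)
  then show "prob_space (mu1 T \<rho>)" "sets (mu1 T \<rho>) = sets Omega"
    unfolding mu1_bind using eigenpair_kernel_measurable by (rule prob_space_bind', rule sets_bind')
qed

text \<open>After spectral averaging at each site, the integration variables are \<open>w\<close>
  and \<open>l\<close>, which are exactly the random inputs of \<open>mu2\<close>.\<close>

lemma emeasure_mu1:
  assumes A: "A \<in> Omega_sets"
  shows "emeasure (mu1 T \<rho>) A = (\<Sum>x\<in>UNIV. ennreal (1 / CARD('n)) *
    (\<integral>\<^sup>+w. \<integral>\<^sup>+l. indicator (resolvent_domain x w) l *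
      (dens x (- 1 / rcol T x w l $ x) * (indicator {0..1} l * indicator A (rec_quad T x w l))) \<partial>lborel
     \<partial>Pi\<^sub>M (UNIV - {x}) \<rho>))"
proof -
  let ?R = "restrict_space (potential_law \<rho>) (good_potentials T)"
  let ?h = "\<lambda>x v. (\<Sum>l\<in>spec (ham T v). spectral_weight T A x v l) * indicator (good_potentials T) v"
  let ?c = "ennreal (1 / CARD('n))"
  have gs: "good_potentials T \<inter> space (potential_law \<rho>) \<in> sets (potential_law \<rho>)"
    using good_sets by simp
  have sp: "space ?R = good_potentials T"
    using sets_eq_imp_space_eq[OF sets_potential] by (simp add: space_restrict_space)
  have hm: "?h x \<in> borel_measurable borel" for x by (rule borel_measurable_good_spectral_sum[OF A])
  then have [measurable]: "?h x \<in> borel_measurable (potential_law \<rho>)" for x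
    using measurable_cong_sets[OF sets_potential refl] by blast
  have "emeasure (mu1 T \<rho>) A = (\<integral>\<^sup>+v. emeasure (eigenpair_kernel T v) A \<partial>?R)"
    unfolding mu1_bind using prob_space.not_empty[OF prob_space_restricted] A
    by (intro emeasure_bind[where N = Omega] measurable_prob_algebraD[OF eigenpair_kernel_measurable])
      (auto simp: sets_Omega)
  also have "\<dots> = (\<integral>\<^sup>+v. emeasure (eigenpair_kernel T v) A * indicator (good_potentials T) v \<partial>potential_law \<rho>)"
    by (rule nn_integral_restrict_space[OF gs])
  also have "\<dots> = (\<integral>\<^sup>+v. (\<Sum>x\<in>UNIV. ?c * ?h x v) \<partial>potential_law \<rho>)"
    by (intro nn_integral_cong)
      (simp add: eigenpair_kernel(3)[OF sym _ A] sum_distrib_left sum_distrib_right mult.assoc split: split_indicator)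
  also have "\<dots> = (\<Sum>x\<in>UNIV. \<integral>\<^sup>+v. ?c * ?h x v \<partial>potential_law \<rho>)"
    by (rule nn_integral_sum) measurable
  also have "\<dots> = (\<Sum>x\<in>UNIV. ?c * (\<integral>\<^sup>+v. ?h x v \<partial>potential_law \<rho>))"
    by (intro sum.cong refl nn_integral_cmult) measurable
  also have "\<dots> = (\<Sum>x\<in>UNIV. ?c * (\<integral>\<^sup>+w. \<integral>\<^sup>+a. ?h x (set_at x a w) \<partial>\<rho> x \<partial>Pi\<^sub>M (UNIV - {x}) \<rho>))"
    by (intro sum.cong refl arg_cong2[where f = "(*)"] nn_integral_potential hm)
  also have "\<dots> = (\<Sum>x\<in>UNIV. ?c * (\<integral>\<^sup>+w. \<integral>\<^sup>+l. indicator (resolvent_domain x w) l *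
      (dens x (- 1 / rcol T x w l $ x) * (indicator {0..1} l * indicator A (rec_quad T x w l))) \<partial>lborel
     \<partial>Pi\<^sub>M (UNIV - {x}) \<rho>))"
  proof (intro sum.cong refl arg_cong2[where f = "(*)"] nn_integral_cong_AE)
    fix x
    show "AE w in Pi\<^sub>M (UNIV - {x}) \<rho>. (\<integral>\<^sup>+a. ?h x (set_at x a w) \<partial>\<rho> x) = (\<integral>\<^sup>+l. indicator (resolvent_domain x w) l *
      (dens x (- 1 / rcol T x w l $ x) * (indicator {0..1} l * indicator A (rec_quad T x w l))) \<partial>lborel)"
      using AE_good_fibres[of x] by eventually_elim (rule spectral_averaging[OF A _ hm])
  qed
  finally show ?thesis .
qed

end

section \<open>The law \<open>mu2\<close> and the density\<close>

context random_hamiltonian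
begin

abbreviation pair_law :: "'n \<Rightarrow> (real \<times> ('n \<Rightarrow> real)) measure" where
  "pair_law x \<equiv> uniform_measure lborel {0..1} \<Otimes>\<^sub>M Pi\<^sub>M (UNIV - {x}) \<rho>"

lemma prob_space_uniform: "prob_space (uniform_measure lborel {0..1::real})"
  by (rule prob_space_uniform_measure) simp_all

lemma prob_space_pair_law: "prob_space (pair_law x)"
proof -
  interpret pair_prob_space "uniform_measure lborel {0..1::real}" "Pi\<^sub>M (UNIV - {x}) \<rho>"
    by (intro pair_prob_space.intro pair_sigma_finite.intro prob_space_imp_sigma_finite
        prob_space_uniform prob_space_PiM prob)
  show ?thesis by (rule prob_space_axioms)
qed

lemma borel_measurable_pair_law:
  "fst \<in> borel_measurable (pair_law x)"
  "y \<noteq> x \<Longrightarrow> (\<lambda>p. snd p y) \<in> borel_measurable (pair_law x)"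
proof -
  have "sets (uniform_measure lborel {0..1::real}) = sets borel" by simp
  then show "fst \<in> borel_measurable (pair_law x)"
    using measurable_fst measurable_cong_sets[OF refl] by blast
  show "(\<lambda>p. snd p y) \<in> borel_measurable (pair_law x)" if "y \<noteq> x"
    by (rule measurable_compose[OF measurable_snd borel_measurable_component]) (use that in simp)
qed

lemma good_pairs_domain: "(l, w) \<in> good_pairs T x \<longleftrightarrow> l \<in> {0..1} \<and> l \<in> resolvent_domain x w"
  by (simp add: good_pairs_iff)

lemma reconstruct_rec_quad: "(l, w) \<in> good_pairs T x \<Longrightarrow> reconstruct T x (l, w) = rec_quad T x w l"
  by (simp add: reconstruct_good rec_quad_def)

lemma rec_quad_in_Omega_set: "(l, w) \<in> good_pairs T x \<Longrightarrow> rec_quad T x w l \<in> Omega_set"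
  by (auto simp: good_pairs_iff rec_quad_def Omega_set_def)

lemma sets_domain_pairs: "{p \<in> space (pair_law x). fst p \<in> resolvent_domain x (snd p)} \<in> sets (pair_law x)"
  using sets_resolvent_domain[OF borel_measurable_pair_law(1) borel_measurable_pair_law(2)] by simp

lemma sets_good_pairs: "good_pairs T x \<inter> space (pair_law x) \<in> sets (pair_law x)"
proof -
  have "fst -` {0..1} \<inter> space (pair_law x) \<in> sets (pair_law x)"
    by (rule measurable_sets[OF borel_measurable_pair_law(1)]) simp
  then have "(fst -` {0..1} \<inter> space (pair_law x)) \<inter> {p \<in> space (pair_law x). fst p \<in> resolvent_domain x (snd p)} \<in> sets (pair_law x)"
    using sets_domain_pairs by (rule sets.Int)
  also have "(fst -` {0..1} \<inter> space (pair_law x)) \<inter> {p \<in> space (pair_law x). fst p \<in> resolvent_domain x (snd p)}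
      = good_pairs T x \<inter> space (pair_law x)"
  proof (intro set_eqI iffI)
    fix p assume "p \<in> (fst -` {0..1} \<inter> space (pair_law x)) \<inter> {p \<in> space (pair_law x). fst p \<in> resolvent_domain x (snd p)}"
    then show "p \<in> good_pairs T x \<inter> space (pair_law x)" using good_pairs_domain[of "fst p" "snd p" x] by simp
  next
    fix p assume "p \<in> good_pairs T x \<inter> space (pair_law x)"
    then show "p \<in> (fst -` {0..1} \<inter> space (pair_law x)) \<inter> {p \<in> space (pair_law x). fst p \<in> resolvent_domain x (snd p)}"
      using good_pairs_domain[of "fst p" "snd p" x] by simp
  qed
  finally show ?thesis .
qed

lemma AE_good_pairs: "AE p in pair_law x. p \<in> good_pairs T x"
proof -
  interpret P: pair_sigma_finite "uniform_measure lborel {0..1::real}" "Pi\<^sub>M (UNIV - {x}) \<rho>"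
    by (intro pair_sigma_finite.intro prob_space_imp_sigma_finite prob_space_uniform prob_space_PiM prob)
  have S: "{p \<in> space (pair_law x). (fst p, snd p) \<in> good_pairs T x} \<in> sets (pair_law x)"
    using sets_good_pairs[of x] by (simp add: Int_def conj_commute)
  have "AE l in uniform_measure lborel {0..1}. (l, w) \<in> good_pairs T x" for w
  proof (rule AE_uniform_measureI)
    have "finite (- resolvent_domain x w)" using finite_bad_energies[OF sym, of x w] by (simp add: Compl_eq)
    then have "AE l in lborel. l \<notin> - resolvent_domain x w" by (intro AE_not_in finite_imp_null_set_lborel)
    then show "AE l in lborel. l \<in> {0..1} \<longrightarrow> (l, w) \<in> good_pairs T x"
      by eventually_elim (simp add: good_pairs_domain)
  qed simp
  then have "AE w in Pi\<^sub>M (UNIV - {x}) \<rho>. AE l in uniform_measure lborel {0..1}. (l, w) \<in> good_pairs T x" by simp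
  \<comment> \<open>Finiteness controls the bad energies for fixed \<open>w\<close>, but the product
    has the energy as its first factor, so the order of the two quantifiers is exchanged.\<close>
  then have "AE l in uniform_measure lborel {0..1}. AE w in Pi\<^sub>M (UNIV - {x}) \<rho>. (l, w) \<in> good_pairs T x"
    using P.AE_commute[OF S] by blast
  then show ?thesis
    using S by (intro P.AE_pair_measure) simp_all
qed

lemma prob_space_good_pairs: "prob_space (restrict_space (pair_law x) (good_pairs T x))"
proof (rule prob_spaceI)
  have "emeasure (pair_law x) (good_pairs T x \<inter> space (pair_law x)) = 1"
    using AE_good_pairs[of x]
    by (intro prob_space.emeasure_eq_1_AE[OF prob_space_pair_law] sets_good_pairs) auto
  then show "emeasure (restrict_space (pair_law x) (good_pairs T x)) (space (restrict_space (pair_law x) (good_pairs T x))) = 1"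
    using sets_good_pairs[of x] by (simp add: space_restrict_space emeasure_restrict_space)
qed

lemma measurable_reconstruct: "reconstruct T x \<in> restrict_space (pair_law x) (good_pairs T x) \<rightarrow>\<^sub>M Omega"
  (is "_ \<in> ?R \<rightarrow>\<^sub>M _")
proof (rule measurable_OmegaI)
  have "(\<lambda>p. rec_quad T x (snd p) (fst p)) \<in> pair_law x \<rightarrow>\<^sub>M quad_borel"
    by (rule measurable_rec_quad) (auto intro: borel_measurable_pair_law)
  then have "(\<lambda>p. rec_quad T x (snd p) (fst p)) \<in> ?R \<rightarrow>\<^sub>M quad_borel" by (rule measurable_restrict_space1)
  also have "?this \<longleftrightarrow> reconstruct T x \<in> ?R \<rightarrow>\<^sub>M quad_borel"
  proof (rule measurable_cong)
    fix p assume "p \<in> space ?R"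
    then show "rec_quad T x (snd p) (fst p) = reconstruct T x p"
      using reconstruct_rec_quad[of "fst p" "snd p" x] by (simp add: space_restrict_space)
  qed
  finally show "reconstruct T x \<in> ?R \<rightarrow>\<^sub>M quad_borel" .
  fix p assume "p \<in> space ?R"
  then show "reconstruct T x p \<in> Omega_set"
    using reconstruct_rec_quad[of "fst p" "snd p" x] rec_quad_in_Omega_set[of "fst p" "snd p" x]
    by (simp add: space_restrict_space)
qed

abbreviation site_law :: "'n \<Rightarrow> 'n quad measure" where
  "site_law x \<equiv> distr (restrict_space (pair_law x) (good_pairs T x)) Omega (reconstruct T x)"

lemma site_law_measurable: "site_law \<in> uniform_count_measure UNIV \<rightarrow>\<^sub>M prob_algebra Omega"
  unfolding measurable_def
  by (auto simp: space_prob_algebra sets_uniform_count_measure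
      intro: prob_space.prob_space_distr[OF prob_space_good_pairs measurable_reconstruct])

lemma mu2_prob: "prob_space (mu2 T \<rho>)" "sets (mu2 T \<rho>) = sets Omega"
proof -
  have "prob_space (uniform_count_measure (UNIV :: 'n set))"
    by (intro prob_spaceI) (simp add: space_uniform_count_measure emeasure_uniform_count_measure)
  then have U: "uniform_count_measure (UNIV :: 'n set) \<in> space (prob_algebra (uniform_count_measure UNIV))"
    by (simp add: space_prob_algebra)
  show "prob_space (mu2 T \<rho>)" "sets (mu2 T \<rho>) = sets Omega"
    unfolding mu2_def by (rule prob_space_bind'[OF U site_law_measurable], rule sets_bind'[OF U site_law_measurable])
qed

text \<open>The integral over \<open>w\<close> is placed outside so that the result has the same
  shape as \<open>emeasure_mu1\<close>.\<close>

lemma nn_integral_site_law: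
  assumes F: "F \<in> borel_measurable Omega"
  shows "(\<integral>\<^sup>+q. F q \<partial>site_law x) = (\<integral>\<^sup>+w. \<integral>\<^sup>+l. indicator (resolvent_domain x w) l *
      (indicator {0..1} l * F (rec_quad T x w l)) \<partial>lborel \<partial>Pi\<^sub>M (UNIV - {x}) \<rho>)"
proof -
  let ?R = "restrict_space (pair_law x) (good_pairs T x)"
  interpret P: pair_sigma_finite "uniform_measure lborel {0..1::real}" "Pi\<^sub>M (UNIV - {x}) \<rho>"
    by (intro pair_sigma_finite.intro prob_space_imp_sigma_finite prob_space_uniform prob_space_PiM prob)
  let ?G = "\<lambda>p. F (reconstruct T x p) * indicator (good_pairs T x) p"
  have "(\<lambda>p. F (reconstruct T x p)) \<in> borel_measurable ?R"
    by (rule measurable_compose[OF measurable_reconstruct F])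
  then have G: "?G \<in> borel_measurable (pair_law x)"
    by (subst borel_measurable_restrict_space_iff_ennreal[OF sets_good_pairs, symmetric])
  have "(\<integral>\<^sup>+q. F q \<partial>site_law x) = (\<integral>\<^sup>+p. F (reconstruct T x p) \<partial>?R)"
    by (rule nn_integral_distr[OF measurable_reconstruct]) (simp add: F)
  also have "\<dots> = (\<integral>\<^sup>+p. ?G p \<partial>pair_law x)"
    by (rule nn_integral_restrict_space[OF sets_good_pairs])
  also have "\<dots> = (\<integral>\<^sup>+w. \<integral>\<^sup>+l. ?G (l, w) \<partial>uniform_measure lborel {0..1} \<partial>Pi\<^sub>M (UNIV - {x}) \<rho>)"
    by (rule P.nn_integral_snd[OF G, symmetric])
  also have "\<dots> = (\<integral>\<^sup>+w. \<integral>\<^sup>+l. indicator (resolvent_domain x w) l *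
      (indicator {0..1} l * F (rec_quad T x w l)) \<partial>lborel \<partial>Pi\<^sub>M (UNIV - {x}) \<rho>)"
  proof (rule nn_integral_cong)
    fix w assume w: "w \<in> space (Pi\<^sub>M (UNIV - {x}) \<rho>)"
    have "(\<lambda>l. ?G (l, w)) \<in> borel_measurable (uniform_measure lborel {0..1})"
      by (rule measurable_compose[OF measurable_Pair2'[OF w] G])
    then have "(\<lambda>l. ?G (l, w)) \<in> borel_measurable lborel"
      by (simp add: measurable_cong_sets[OF sets_uniform_measure refl])
    \<comment> \<open>The unit interval has Lebesgue measure 1, so no normalizing constant appears
      in the final density.\<close>
    then have "(\<integral>\<^sup>+l. ?G (l, w) \<partial>uniform_measure lborel {0..1}) = (\<integral>\<^sup>+l. ?G (l, w) * indicator {0..1} l \<partial>lborel)"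
      by (subst nn_integral_uniform_measure) (simp_all add: divide_ennreal_def)
    also have "\<dots> = (\<integral>\<^sup>+l. indicator (resolvent_domain x w) l * (indicator {0..1} l * F (rec_quad T x w l)) \<partial>lborel)"
    proof (rule nn_integral_cong)
      fix l
      show "?G (l, w) * indicator {0..1} l = indicator (resolvent_domain x w) l * (indicator {0..1} l * F (rec_quad T x w l))"
      proof (cases "(l, w) \<in> good_pairs T x")
        case True
        then show ?thesis using good_pairs_domain[of l w x] reconstruct_rec_quad[OF True] by simp
      next
        case False
        then have "l \<notin> resolvent_domain x w \<inter> {0..1}" using good_pairs_domain[of l w x] by blast
        then have "indicator (resolvent_domain x w) l * indicator {0..1} l = (0 :: ennreal)"
          unfolding indicator_inter_arith[symmetric] by (rule indicator_simps(2))
        then show ?thesis unfolding mult.assoc[symmetric] using False by simp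
      qed
    qed
    finally show "(\<integral>\<^sup>+l. ?G (l, w) \<partial>uniform_measure lborel {0..1}) = \<dots>" .
  qed
  finally show ?thesis .
qed

lemma nn_integral_mu2:
  assumes F: "F \<in> borel_measurable Omega"
  shows "(\<integral>\<^sup>+q. F q \<partial>mu2 T \<rho>) = (\<Sum>x\<in>UNIV. ennreal (1 / CARD('n)) * (\<integral>\<^sup>+q. F q \<partial>site_law x))"
proof -
  have "(\<integral>\<^sup>+q. F q \<partial>mu2 T \<rho>) = (\<integral>\<^sup>+x. \<integral>\<^sup>+q. F q \<partial>site_law x \<partial>uniform_count_measure UNIV)"
    unfolding mu2_def by (rule nn_integral_bind[OF F measurable_prob_algebraD[OF site_law_measurable]])
  also have "\<dots> = (\<Sum>x\<in>UNIV. ennreal (1 / CARD('n)) * (\<integral>\<^sup>+q. F q \<partial>site_law x))"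
    unfolding uniform_count_measure_def by (rule nn_integral_point_measure_finite) simp
  finally show ?thesis .
qed

section \<open>The Radon-Nikodym derivative\<close>

definition site_density :: "'n quad \<Rightarrow> ennreal" where
  "site_density = (\<lambda>(v, l, \<phi>, x). dens x (v $ x))"

lemma borel_measurable_site_density: "site_density \<in> borel_measurable Omega"
proof (rule borel_measurable_Omega)
  \<comment> \<open>The site selects which density is used, so the function is split into finitely
    many slices of constant site.\<close>
  have "(\<lambda>q :: 'n quad. \<Sum>x\<in>UNIV. indicator {q. snd (snd (snd q)) = x} q * dens x (fst q $ x)) \<in> borel_measurable quad_borel"
  proof (intro borel_measurable_sum borel_measurable_times_ennreal)
    fix x :: 'n
    show "(\<lambda>q :: 'n quad. dens x (fst q $ x)) \<in> borel_measurable quad_borel"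
      by (rule measurable_compose[OF borel_measurable_vec_nth[OF measurable_fst] borel_measurable_dens])
    have "(\<lambda>q :: 'n quad. snd (snd (snd q))) \<in> quad_borel \<rightarrow>\<^sub>M count_space UNIV" by measurable
    then have "(\<lambda>q :: 'n quad. snd (snd (snd q))) -` {x} \<inter> space quad_borel \<in> sets quad_borel"
      by (rule measurable_sets) simp
    then show "indicator {q :: 'n quad. snd (snd (snd q)) = x} \<in> borel_measurable quad_borel"
      by (intro borel_measurable_indicator) (simp add: space_pair_measure vimage_def)
  qed
  also have "(\<lambda>q :: 'n quad. \<Sum>x\<in>UNIV. indicator {q. snd (snd (snd q)) = x} q * dens x (fst q $ x)) = site_density"
  proof
    fix q :: "'n quad"
    have "(\<Sum>x\<in>UNIV. indicator {q. snd (snd (snd q)) = x} q * dens x (fst q $ x))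
        = (\<Sum>x\<in>UNIV. if x = snd (snd (snd q)) then dens x (fst q $ x) else 0)"
      by (intro sum.cong) (auto simp: indicator_def)
    also have "\<dots> = site_density q" by (simp add: site_density_def case_prod_beta)
    finally show "(\<Sum>x\<in>UNIV. indicator {q. snd (snd (snd q)) = x} q * dens x (fst q $ x)) = site_density q" .
  qed
  finally show "site_density \<in> borel_measurable quad_borel" .
  show "site_density (flip q) = site_density q" for q by (simp add: site_density_def flip_def case_prod_beta)
qed

text \<open>The potential at \<open>x\<close> of a reconstructed quadruple is the coupling belonging
  to \<open>l\<close>, which turns the density into the factor left over by spectral
  averaging.\<close>

lemma site_density_rec_quad: "site_density (rec_quad T x w l) = dens x (- 1 / rcol T x w l $ x)"
  by (simp add: site_density_def rec_quad_def set_at_def)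

text \<open>Both measures of a set have been brought to the same iterated integral, and the
  remaining difference is the order of the factors.\<close>

lemma mu1_density: "density (mu2 T \<rho>) site_density = mu1 T \<rho>"
proof (rule measure_eqI)
  show "sets (density (mu2 T \<rho>) site_density) = sets (mu1 T \<rho>)" by (simp add: mu1_prob mu2_prob)
  fix A assume "A \<in> sets (density (mu2 T \<rho>) site_density)"
  then have A': "A \<in> sets (mu2 T \<rho>)" and A: "A \<in> Omega_sets" by (simp_all add: mu2_prob sets_Omega)
  have m: "site_density \<in> borel_measurable (mu2 T \<rho>)"
    using borel_measurable_site_density measurable_cong_sets[OF mu2_prob(2) refl] by blast
  have F: "(\<lambda>q. site_density q * indicator A q) \<in> borel_measurable Omega"
    using A by (intro borel_measurable_times_ennreal borel_measurable_site_density borel_measurable_indicator)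
      (simp add: sets_Omega)
  have "emeasure (density (mu2 T \<rho>) site_density) A = (\<integral>\<^sup>+q. site_density q * indicator A q \<partial>mu2 T \<rho>)"
    by (rule emeasure_density[OF m A'])
  also have "\<dots> = emeasure (mu1 T \<rho>) A"
    unfolding nn_integral_mu2[OF F] nn_integral_site_law[OF F] emeasure_mu1[OF A] site_density_rec_quad
    by (simp only: mult.left_commute)
  finally show "emeasure (density (mu2 T \<rho>) site_density) A = emeasure (mu1 T \<rho>) A" .
qed

text \<open>A density that represents \<open>mu1\<close> with respect to the \<sigma>-finite
  \<open>mu2\<close> is almost everywhere the Radon-Nikodym derivative.\<close>

lemma RN_deriv_mu1:
  "absolutely_continuous (mu2 T \<rho>) (mu1 T \<rho>)"
  "AE (v, l, \<phi>, x) in mu2 T \<rho>. RN_deriv (mu2 T \<rho>) (mu1 T \<rho>) (v, l, \<phi>, x) = dens x (v $ x)"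
proof -
  have m: "site_density \<in> borel_measurable (mu2 T \<rho>)"
    using borel_measurable_site_density measurable_cong_sets[OF mu2_prob(2) refl] by blast
  show "absolutely_continuous (mu2 T \<rho>) (mu1 T \<rho>)"
    using absolutely_continuousI_density[OF m] unfolding mu1_density .
  have "AE q in mu2 T \<rho>. site_density q = RN_deriv (mu2 T \<rho>) (mu1 T \<rho>) q"
    by (rule sigma_finite_measure.RN_deriv_unique[OF prob_space_imp_sigma_finite[OF mu2_prob(1)] m mu1_density])
  then show "AE (v, l, \<phi>, x) in mu2 T \<rho>. RN_deriv (mu2 T \<rho>) (mu1 T \<rho>) (v, l, \<phi>, x) = dens x (v $ x)"
    by eventually_elim (auto simp: site_density_def)
qed

end

theorem theorem3:
  fixes T :: "real^'n^'n" and \<rho> :: "'n \<Rightarrow> real measure"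
  assumes "transpose T = T"
    and "\<And>x. prob_space (\<rho> x)" and "\<And>x. sets (\<rho> x) = sets borel"
    and "\<And>x. absolutely_continuous lborel (\<rho> x)"
    and "AE v in potential_law \<rho>. spec (ham T v) \<subseteq> {0..1}"
    and "AE v in potential_law \<rho>. nondegenerate (ham T v)"
  shows "prob_space (mu1 T \<rho>) \<and> prob_space (mu2 T \<rho>)
    \<and> absolutely_continuous (mu2 T \<rho>) (mu1 T \<rho>)
    \<and> (AE (v, l, \<phi>, x) in mu2 T \<rho>.
         RN_deriv (mu2 T \<rho>) (mu1 T \<rho>) (v, l, \<phi>, x) = RN_deriv lborel (\<rho> x) (v $ x))"
proof -
  have "AE v in potential_law \<rho>. v \<in> good_potentials T"
    using assms(5,6) by eventually_elim (simp add: good_potentials_def)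
  with assms(1-4) interpret random_hamiltonian T \<rho> by (rule random_hamiltonian.intro)
  show ?thesis using mu1_prob(1) mu2_prob(1) RN_deriv_mu1 by blast
qed

end
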